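(* Let $A$ be a densely defined closed operator in a complex Hilbert space $\mathcal{H}$ such that $\operatorname{Num}(A)$ has an interior point, $\operatorname{Num}(A)\neq\mathbb{C}$, $\operatorname{D}(A)\subset\operatorname{D}(A^* )$ and $\sigma(A)\subset\overline{\operatorname{Num}}(A)$. If $\lambda\in\partial\operatorname{Num}(A)$ is a point of unilateral infinite curvature of $\partial\overline{\operatorname{Num}}(A)$ but not a corner point, then $\operatorname{Ran}(A-\lambda I)$ is not closed. In particular, $\lambda\in\sigma_{ess}(A)$.
   Context: $\operatorname{Num}(A)=\{\langle Af,f\rangle: f\in\operatorname{D}(A),\|f\|=1\}$, $\overline{\operatorname{Num}}(A)$ its closure. $\sigma_{ess}(A)=\{\lambda\in\mathbb{C}: A-\lambda I \text{ is not Fredholm}\}$, where an operator is Fredholm if it has closed range and finite-dimensional kernel and cokernel. Curvature conventions. Let $\Omega\subset\mathbb{C}$ be a closed convex set with nonempty interior and $\lambda\in\partial\Omega$. There is at least one supporting line of $\Omega$ through $\lambda$; $\lambda$ is called a corner point if there is more than one. If $\lambda$ is a corner point, $\Omega$ lies in a closed sector with vertex $\lambda$ and semivertical angle $<\pi/2$; take the smallest such sector and let $l_\lambda$ be the supporting line through $\lambda$ orthogonal to the axis of this sector; otherwise $l_\lambda$ is the unique supporting line. Use rectangular coordinates $(\xi,\eta)$ with origin at $\lambda$, $\xi$-axis equal to $l_\lambda$, oriented so that $\Omega\subset\{\eta\ge 0\}$. Let $D'_\varepsilon=\{(\xi,\eta):\xi^2+\eta^2\le\varepsilon^2,\ \xi\neq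 0\}$. Define $\gamma_u^+(\lambda)=\lim_{\varepsilon\downarrow 0}\sup\{\eta/\xi^2:(\xi,\eta)\in\partial\Omega\cap D'_\varepsilon,\ \xi>0\}$ and $\gamma_l^+(\lambda)$ the same with $\inf$ in place of $\sup$; $\gamma_u^-(\lambda),\gamma_l^-(\lambda)$ are defined analogously with $\xi<0$. Set $\gamma_u(\lambda)=\max(\gamma_u^+(\lambda),\gamma_u^-(\lambda))$, $\gamma_l(\lambda)=\min(\gamma_l^+(\lambda),\gamma_l^-(\lambda))$. The point $\lambda$ is of infinite upper curvature if $\gamma_u(\lambda)=\infty$, and of unilateral infinite curvature if $\gamma_l^+(\lambda)=\infty$ or $\gamma_l^-(\lambda)=\infty$. For an operator $A$, these notions at $\lambda\in\partial\operatorname{Num}(A)$ refer to $\Omega=\overline{\operatorname{Num}}(A)$. *)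

theory Defs
  imports "HOL-Analysis.Analysis"
begin

class complex_vector = real_vector +
  fixes scaleC :: "complex \<Rightarrow> 'a \<Rightarrow> 'a" (infixr \<open>*\<^sub>C\<close> 75)
  assumes scaleR_scaleC: "scaleR r x = scaleC (complex_of_real r) x"
    and scaleC_add_right: "scaleC a (x + y) = scaleC a x + scaleC a y"
    and scaleC_add_left: "scaleC (a + b) x = scaleC a x + scaleC b x"
    and scaleC_scaleC: "scaleC a (scaleC b x) = scaleC (a * b) x"
    and scaleC_one: "scaleC 1 x = x"

class complex_inner = complex_vector + real_normed_vector +
  fixes cinner :: "'a \<Rightarrow> 'a \<Rightarrow> complex"
  assumes cinner_commute: "cinner x y = cnj (cinner y x)"
    and cinner_add_left: "cinner (x + y) z = cinner x z + cinner y z"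
    and cinner_scaleC_left: "cinner (scaleC r x) y = r * cinner x y"
    and cinner_ge_zero: "0 \<le> Re (cinner x x)"
    and cinner_eq_zero_iff: "cinner x x = 0 \<longleftrightarrow> x = 0"
    and norm_eq_sqrt_cinner: "norm x = sqrt (Re (cinner x x))"

class chilbert_space = complex_inner + complete_space

definition complex_subspace :: "'a::complex_vector set \<Rightarrow> bool" where
  "complex_subspace S \<longleftrightarrow> 0 \<in> S \<and> (\<forall>x\<in>S. \<forall>y\<in>S. x + y \<in> S) \<and> (\<forall>c. \<forall>x\<in>S. c *\<^sub>C x \<in> S)"

definition linear_operator :: "'a::complex_vector set \<Rightarrow> ('a \<Rightarrow> 'a) \<Rightarrow> bool" where
  "linear_operator D A \<longleftrightarrow> complex_subspace D \<and>
     (\<forall>x\<in>D. \<forall>y\<in>D. A (x + y) = A x + A y) \<and> (\<forall>c. \<forall>x\<in>D. A (c *\<^sub>C x) = c *\<^sub>C A x)"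

definition densely_defined :: "'a::complex_inner set \<Rightarrow> bool" where
  "densely_defined D \<longleftrightarrow> closure D = UNIV"

definition graph :: "'a set \<Rightarrow> ('a \<Rightarrow> 'a) \<Rightarrow> ('a \<times> 'a) set" where
  "graph D A = {(x, A x) | x. x \<in> D}"

definition closed_operator :: "'a::complex_inner set \<Rightarrow> ('a \<Rightarrow> 'a) \<Rightarrow> bool" where
  "closed_operator D A \<longleftrightarrow> linear_operator D A \<and> closed (graph D A)"

definition adjoint_domain :: "'a::complex_inner set \<Rightarrow> ('a \<Rightarrow> 'a) \<Rightarrow> 'a set" where
  "adjoint_domain D A = {g. \<exists>h. \<forall>f\<in>D. cinner (A f) g = cinner f h}"

definition num_range :: "'a::complex_inner set \<Rightarrow> ('a \<Rightarrow> 'a) \<Rightarrow> complex set" where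
  "num_range D A = {cinner (A f) f | f. f \<in> D \<and> norm f = 1}"

definition spectrum_op :: "'a::complex_inner set \<Rightarrow> ('a \<Rightarrow> 'a) \<Rightarrow> complex set" where
  "spectrum_op D A = {\<mu>. \<not> (bij_betw (\<lambda>f. A f - \<mu> *\<^sub>C f) D UNIV \<and>
       (\<exists>C. \<forall>y. norm (the_inv_into D (\<lambda>f. A f - \<mu> *\<^sub>C f) y) \<le> C * norm y))}"

definition cspan_fin :: "'a::complex_vector set \<Rightarrow> 'a set" where
  "cspan_fin F = {x. \<exists>c. x = (\<Sum>f\<in>F. c f *\<^sub>C f)}"

definition fredholm :: "'a::complex_inner set \<Rightarrow> ('a \<Rightarrow> 'a) \<Rightarrow> bool" where
  "fredholm D T \<longleftrightarrow> closed (T ` D)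
     \<and> (\<exists>F. finite F \<and> {x\<in>D. T x = 0} \<subseteq> cspan_fin F)
     \<and> (\<exists>F. finite F \<and> (\<forall>y. \<exists>r\<in>T ` D. \<exists>s\<in>cspan_fin F. y = r + s))"

definition ess_spectrum :: "'a::complex_inner set \<Rightarrow> ('a \<Rightarrow> 'a) \<Rightarrow> complex set" where
  "ess_spectrum D A = {\<mu>. \<not> fredholm D (\<lambda>f. A f - \<mu> *\<^sub>C f)}"

definition line_through :: "complex \<Rightarrow> complex \<Rightarrow> complex set" where
  "line_through a u = {a + complex_of_real t * u | t. True}"

definition supporting_line :: "complex set \<Rightarrow> complex \<Rightarrow> complex set \<Rightarrow> bool" where
  "supporting_line \<Omega> a L \<longleftrightarrow> (\<exists>u. u \<noteq> 0 \<and> L = line_through a u \<and>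
      ((\<forall>z\<in>\<Omega>. 0 \<le> Im ((z - a) / u)) \<or> (\<forall>z\<in>\<Omega>. Im ((z - a) / u) \<le> 0)))"

definition corner_point :: "complex set \<Rightarrow> complex \<Rightarrow> bool" where
  "corner_point \<Omega> a \<longleftrightarrow> (\<exists>L1 L2. supporting_line \<Omega> a L1 \<and> supporting_line \<Omega> a L2 \<and> L1 \<noteq> L2)"

text \<open>Rectangular coordinates \<open>(\<xi>,\<eta>)\<close> with origin \<open>a\<close>, \<open>\<xi>\<close>-axis the line \<open>L\<close>:
given by a unit vector \<open>e\<close> along \<open>L\<close> via \<open>\<xi> + i\<eta> = (z - a) * cnj e\<close>, oriented so
that \<open>\<Omega> \<subseteq> {\<eta> \<ge> 0}\<close>.\<close>
definition frame_dir :: "complex set \<Rightarrow> complex \<Rightarrow> complex set \<Rightarrow> complex" where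
  "frame_dir \<Omega> a L = (SOME e. norm e = 1 \<and> L = line_through a e \<and>
                         (\<forall>z\<in>\<Omega>. 0 \<le> Im ((z - a) * cnj e)))"

definition xi_coord :: "complex set \<Rightarrow> complex \<Rightarrow> complex set \<Rightarrow> complex \<Rightarrow> real" where
  "xi_coord \<Omega> a L z = Re ((z - a) * cnj (frame_dir \<Omega> a L))"

definition eta_coord :: "complex set \<Rightarrow> complex \<Rightarrow> complex set \<Rightarrow> complex \<Rightarrow> real" where
  "eta_coord \<Omega> a L z = Im ((z - a) * cnj (frame_dir \<Omega> a L))"

text \<open>The line \<open>l_\<lambda>\<close> at a non-corner point: the unique supporting line.
(Only this case is used below.)\<close>
definition l_line :: "complex set \<Rightarrow> complex \<Rightarrow> complex set" where
  "l_line \<Omega> a = (THE L. supporting_line \<Omega> a L)"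

text \<open>\<open>\<gamma>_l^+(a) = lim_{\<epsilon>\<down>0} inf {\<eta>/\<xi>^2 : (\<xi>,\<eta>) \<in> \<partial>\<Omega> \<inter> D'_\<epsilon>, \<xi> > 0}\<close>, in the
extended reals (inf of the empty set is \<open>+\<infinity>\<close>).\<close>
definition gamma_l_plus :: "complex set \<Rightarrow> complex \<Rightarrow> ereal" where
  "gamma_l_plus \<Omega> a = (let L = l_line \<Omega> a; \<xi> = xi_coord \<Omega> a L; \<eta> = eta_coord \<Omega> a L in
     Lim (at_right (0::real)) (\<lambda>\<epsilon>. Inf {ereal (\<eta> z / (\<xi> z)\<^sup>2) | z.
        z \<in> frontier \<Omega> \<and> (\<xi> z)\<^sup>2 + (\<eta> z)\<^sup>2 \<le> \<epsilon>\<^sup>2 \<and> \<xi> z \<noteq> 0 \<and> \<xi> z > 0}))"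

definition gamma_l_minus :: "complex set \<Rightarrow> complex \<Rightarrow> ereal" where
  "gamma_l_minus \<Omega> a = (let L = l_line \<Omega> a; \<xi> = xi_coord \<Omega> a L; \<eta> = eta_coord \<Omega> a L in
     Lim (at_right (0::real)) (\<lambda>\<epsilon>. Inf {ereal (\<eta> z / (\<xi> z)\<^sup>2) | z.
        z \<in> frontier \<Omega> \<and> (\<xi> z)\<^sup>2 + (\<eta> z)\<^sup>2 \<le> \<epsilon>\<^sup>2 \<and> \<xi> z \<noteq> 0 \<and> \<xi> z < 0}))"

definition unilateral_infinite_curvature :: "complex set \<Rightarrow> complex \<Rightarrow> bool" where
  "unilateral_infinite_curvature \<Omega> a \<longleftrightarrow> gamma_l_plus \<Omega> a = \<infinity> \<or> gamma_l_minus \<Omega> a = \<infinity>"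

end

(* Rotate and translate so that lambda = 0, the supporting line is the real axis and the numerical
range lies in the closed upper half plane; B is the resulting operator. Then i eps (B + i eps)^-1
is a contraction, so closedness of Ran B and uniform boundedness give a bounded right inverse of B
on Ran B, whence D = ker B + (D Int Ran B), an orthogonal sum. There are unit vectors f in
D Int Ran B with <Bf,f> -> 0; if ker B is nonzero this uses that 0 is not a corner point. Choose g
with Bg = f and |g| <= M. By Cauchy-Schwarz for the nonnegative imaginary part, <Bf,g> is close to
<f,Bg> = 1, so <B(f + tg), f + tg> = 2t + O(t^2) with imaginary part O(t^2): for either sign of t the
numerical range reaches points with eta/xi^2 bounded, against infinite curvature. *)

theory Submission
  imports Defs
begin

text \<open>Two scales have to match. For |<Bf,f>| <= t^2, Cauchy-Schwarz takes a square root and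
  gives only <Bf,g> = 1 + O(t); multiplied by the step t this is again O(t^2), the order of a
  parabola. So t is fixed first, from M and the range of the curvature bound, and f afterwards. The
  obstacle is the kernel. Vectors with <Bf,f> near 0 may be kernel vectors, and these are orthogonal
  to Ran B, so Bg = f cannot be solved. Instead f comes from numerical range points of small slope
  over the supporting line, which exist on the curved side because 0 is not a corner. Removing the
  kernel component keeps <Bf,f> and shrinks the norm, so the value moves outward along its ray. Were
  it to land too far out, kernel vectors would bring it back near 0 with the same small slope, which
  infinite curvature forbids. Closedness of Ran B serves twice: it gives the completeness behind
  uniform boundedness, and it keeps the limit of (B + i eps)^-1 y in Ran B. The spectral assumption
  enters as surjectivity of B + i eps for eps > 0.\<close>

section \<open>Complex inner product spaces\<close>

lemma scaleC_zero_left [simp]: "0 *\<^sub>C x = (0::'a::complex_vector)"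
  using scaleR_scaleC [of 0 x] by simp

lemma scaleC_zero_right [simp]: "c *\<^sub>C (0::'a::complex_vector) = 0"
  using scaleC_add_right [of c "0::'a" 0] by simp

lemma scaleC_minus_one: "(- 1) *\<^sub>C x = - (x::'a::complex_vector)"
  using scaleR_scaleC [of "- 1" x] by simp

lemma scaleC_minus_right: "c *\<^sub>C (- x) = - (c *\<^sub>C (x::'a::complex_vector))"
  using scaleC_add_right [of c x "- x"] by (simp add: eq_neg_iff_add_eq_0 add.commute)

lemma scaleC_minus_left: "(- c) *\<^sub>C x = - (c *\<^sub>C (x::'a::complex_vector))"
  using scaleC_add_left [of c "- c" x] by (simp add: eq_neg_iff_add_eq_0 add.commute)

lemma scaleC_diff_right: "c *\<^sub>C (x - y) = c *\<^sub>C x - c *\<^sub>C (y::'a::complex_vector)"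
  using scaleC_add_right [of c x "- y"] by (simp add: scaleC_minus_right)

lemma scaleC_diff_left: "(a - b) *\<^sub>C x = a *\<^sub>C x - b *\<^sub>C (x::'a::complex_vector)"
  using scaleC_add_left [of a "- b" x] by (simp add: scaleC_minus_left)

lemma cinner_add_right: "cinner x (y + z) = cinner x y + cinner x (z::'a::complex_inner)"
  by (metis cinner_add_left cinner_commute complex_cnj_add)

lemma cinner_scaleC_right: "cinner x (c *\<^sub>C y) = cnj c * cinner x (y::'a::complex_inner)"
  by (metis cinner_commute cinner_scaleC_left complex_cnj_mult)

lemma cinner_zero_left [simp]: "cinner 0 (x::'a::complex_inner) = 0"
  using cinner_scaleC_left [of 0 x x] by simp

lemma cinner_zero_right [simp]: "cinner (x::'a::complex_inner) 0 = 0"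
  using cinner_scaleC_right [of x 0 x] by simp

lemma cinner_diff_left: "cinner (x - y) z = cinner x z - cinner y (z::'a::complex_inner)"
  using cinner_add_left [of x "- y" z] cinner_scaleC_left [of "- 1" y z]
  by (simp add: scaleC_minus_one)

lemma cinner_self: "cinner x x = complex_of_real ((norm (x::'a::complex_inner))\<^sup>2)"
proof -
  have "Im (cinner x x) = 0"
    using cinner_commute [of x x] by (metis complex_cnj_cancel_iff Reals_cnj_iff complex_is_Real_iff)
  then show ?thesis
    by (simp add: complex_eq_iff norm_eq_sqrt_cinner cinner_ge_zero)
qed

lemma norm_scaleC: "norm (c *\<^sub>C x) = norm c * norm (x::'a::complex_inner)"
proof -
  have "cinner (c *\<^sub>C x) (c *\<^sub>C x) = c * cnj c * cinner x x"
    by (simp add: cinner_scaleC_left cinner_scaleC_right)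
  then have "complex_of_real ((norm (c *\<^sub>C x))\<^sup>2) = c * cnj c * complex_of_real ((norm x)\<^sup>2)"
    by (simp only: cinner_self)
  also have "\<dots> = complex_of_real ((norm c * norm x)\<^sup>2)"
    by (simp add: complex_mult_cnj cmod_power2 power_mult_distrib)
  finally have "(norm (c *\<^sub>C x))\<^sup>2 = (norm c * norm x)\<^sup>2"
    using of_real_eq_iff by blast
  then show ?thesis
    by (simp add: power2_eq_iff_nonneg)
qed

text \<open>A nonnegative Hermitian form in two variables has nonnegative determinant: with
  \<open>c\<close> opposite in phase to \<open>w\<close> a real quadratic in \<open>t\<close>
  remains, tested at \<open>1 / b\<close>, or far out if \<open>b = 0\<close>. Stated for numbers,
  since it serves both the inner product and the imaginary part of the form of
  \<open>B\<close>.\<close>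

lemma nonneg_hermitian_discriminant:
  fixes a b :: real and w :: complex
  assumes nonneg: "\<And>c. 0 \<le> a + 2 * Re (c * w) + (norm c)\<^sup>2 * b" and "0 \<le> b"
  shows "(norm w)\<^sup>2 \<le> a * b"
proof (cases "w = 0")
  case True
  then show ?thesis using nonneg [of 0] \<open>0 \<le> b\<close> by simp
next
  case False
  define W where "W = (norm w)\<^sup>2"
  have W: "W > 0" using False by (simp add: W_def)
  have t: "0 \<le> a - 2 * t * W + t\<^sup>2 * W * b" for t :: real
  proof -
    have "Re (- (of_real t * cnj w) * w) = - (t * W)"
      unfolding W_def cmod_power2 by (simp add: power2_eq_square algebra_simps)
    moreover have "(norm (- (of_real t * cnj w)))\<^sup>2 = t\<^sup>2 * W"
      by (simp add: W_def norm_mult power_mult_distrib)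
    ultimately show ?thesis
      using nonneg [of "- (of_real t * cnj w)"] by simp
  qed
  show ?thesis
  proof (cases "b = 0")
    case True
    then show ?thesis using t [of "(a + 1) / (2 * W)"] W by simp
  next
    case False
    with \<open>0 \<le> b\<close> have "b > 0" by simp
    then show ?thesis using t [of "1 / b"] W
      unfolding W_def [symmetric] by (simp add: field_simps power2_eq_square)
  qed
qed

lemma norm_cinner_le: "norm (cinner x y) \<le> norm x * norm (y::'a::complex_inner)"
proof -
  have "(norm (cinner y x))\<^sup>2 \<le> (norm x)\<^sup>2 * (norm y)\<^sup>2"
  proof (rule nonneg_hermitian_discriminant)
    fix c
    have "cinner (x + c *\<^sub>C y) (x + c *\<^sub>C y) = cinner x x + (c * cinner y x + cnj (c * cinner y x)) + c * cnj c * cinner y y"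
      using cinner_commute [of x y]
      by (simp add: cinner_add_left cinner_add_right cinner_scaleC_left cinner_scaleC_right algebra_simps)
    then have "Re (cinner (x + c *\<^sub>C y) (x + c *\<^sub>C y)) = (norm x)\<^sup>2 + 2 * Re (c * cinner y x) + (norm c)\<^sup>2 * (norm y)\<^sup>2"
      by (simp add: cinner_self complex_add_cnj complex_mult_cnj cmod_power2 del: complex_cnj_mult)
    then show "0 \<le> (norm x)\<^sup>2 + 2 * Re (c * cinner y x) + (norm c)\<^sup>2 * (norm y)\<^sup>2"
      using cinner_ge_zero [of "x + c *\<^sub>C y"] by simp
  qed simp
  then have "(norm (cinner y x))\<^sup>2 \<le> (norm x * norm y)\<^sup>2"
    by (simp add: power_mult_distrib)
  then have "norm (cinner y x) \<le> norm x * norm y"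
    by (rule power2_le_imp_le) simp
  then show ?thesis by (metis cinner_commute complex_mod_cnj)
qed

lemma bounded_linear_scaleC: "bounded_linear (\<lambda>x::'a::complex_inner. c *\<^sub>C x)"
  by (rule bounded_linear_intro [where K = "norm c"])
     (simp_all add: scaleC_add_right scaleR_scaleC scaleC_scaleC norm_scaleC mult.commute)

section \<open>Uniform boundedness on a closed subspace\<close>

text \<open>\<open>L\<close> is the norm of \<open>T\<close> restricted to \<open>S\<close>, and
  \<open>v\<close> almost attains it. The fraction 2/3 has to exceed the 1/2 that the tail of the
  gliding hump can undo.\<close>

lemma uniform_boundedness_nearly_norming:
  fixes T :: "'a::real_normed_vector \<Rightarrow> 'b::real_normed_vector"
  assumes scale: "\<And>c x. x \<in> S \<Longrightarrow> c *\<^sub>R x \<in> S \<and> T (c *\<^sub>R x) = c *\<^sub>R T x"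
    and bound: "\<And>x. x \<in> S \<Longrightarrow> norm (T x) \<le> N * norm x"
    and y: "y \<in> S" "norm (T y) > c * norm y"
  obtains L v where "L > c" "v \<in> S" "norm v = 1" "norm (T v) \<ge> 2 / 3 * L" "\<And>x. x \<in> S \<Longrightarrow> norm (T x) \<le> L * norm x"
proof -
  define Q where "Q = (\<lambda>x. norm (T x)) ` {x\<in>S. norm x = 1}"
  have unit: "sgn x \<in> S" "norm (sgn x) = 1" "norm (T x) = norm (T (sgn x)) * norm x"
    if "x \<in> S" "x \<noteq> 0" for x
    using scale [OF that(1)] that(2) by (auto simp: sgn_div_norm)
  have "y \<noteq> 0"
    using y scale [OF y(1), of 0] by auto
  have bdd: "bdd_above Q"
    using bound by (fastforce simp: Q_def bdd_above_def)
  have up: "norm (T x) \<le> Sup Q * norm x" if "x \<in> S" for x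
  proof (cases "x = 0")
    case True
    then show ?thesis using bound [OF that] by simp
  next
    case False
    then show ?thesis using unit [OF that False] bdd
      by (metis (mono_tags, lifting) Q_def cSup_upper imageI mem_Collect_eq mult_right_mono norm_ge_zero)
  qed
  have "c < Sup Q"
    using up [OF y(1)] y \<open>y \<noteq> 0\<close> by (metis dual_order.strict_trans1 mult_less_cancel_right_pos zero_less_norm_iff)
  moreover have "\<exists>v. v \<in> S \<and> norm v = 1 \<and> norm (T v) \<ge> 2 / 3 * Sup Q"
  proof (cases "Sup Q > 0")
    case True
    then have "2 / 3 * Sup Q < Sup Q" by simp
    moreover have "Q \<noteq> {}" using unit [OF y(1) \<open>y \<noteq> 0\<close>] by (auto simp: Q_def)
    ultimately obtain q where "q \<in> Q" "q > 2 / 3 * Sup Q"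
      using less_cSup_iff [OF _ bdd] by blast
    then show ?thesis by (auto simp: Q_def intro: less_imp_le)
  next
    case False
    then have "2 / 3 * Sup Q \<le> norm (T (sgn y))" using norm_ge_zero [of "T (sgn y)"] by linarith
    then show ?thesis using unit [OF y(1) \<open>y \<noteq> 0\<close>] by auto
  qed
  ultimately show ?thesis using up that by blast
qed

text \<open>Sokal's gliding hump: instead of Baire's theorem one uses that for every \<open>x\<close> one of
  \<open>x \<plusminus> v\<close> satisfies \<open>\<parallel>T v\<parallel> \<le> \<parallel>T (x \<plusminus> v)\<parallel>\<close>.\<close>
lemma uniform_boundedness_on:
  fixes T :: "'i \<Rightarrow> 'a::{real_normed_vector, complete_space} \<Rightarrow> 'b::real_normed_vector"
  assumes "closed S" and zero: "0 \<in> S"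
    and add: "\<And>x y. x \<in> S \<Longrightarrow> y \<in> S \<Longrightarrow> x + y \<in> S"
    and scale: "\<And>c x. x \<in> S \<Longrightarrow> c *\<^sub>R x \<in> S"
    and T_add: "\<And>i x y. x \<in> S \<Longrightarrow> y \<in> S \<Longrightarrow> T i (x + y) = T i x + T i y"
    and T_scale: "\<And>i c x. x \<in> S \<Longrightarrow> T i (c *\<^sub>R x) = c *\<^sub>R T i x"
    and bound: "\<And>i x. x \<in> S \<Longrightarrow> norm (T i x) \<le> N i * norm x"
    and pointwise: "\<And>x. x \<in> S \<Longrightarrow> \<exists>C. \<forall>i. norm (T i x) \<le> C"
  shows "\<exists>M. \<forall>i. \<forall>x\<in>S. norm (T i x) \<le> M * norm x"
proof (rule ccontr)
  assume "\<not> ?thesis"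
  then have large: "\<exists>i. \<exists>x\<in>S. norm (T i x) > c * norm x" for c
    by (meson not_le)
  \<comment> \<open>Norms above 4^n beat the step lengths 3^-n, so the images will grow like
    (4/3)^n.\<close>
  have "\<exists>i L v. L > 4 ^ n \<and> v \<in> S \<and> norm v = 1 \<and> norm (T i v) \<ge> 2 / 3 * L \<and>
      (\<forall>x\<in>S. norm (T i x) \<le> L * norm x)" for n :: nat
  proof -
    obtain i y where "y \<in> S" "norm (T i y) > 4 ^ n * norm y"
      using large by blast
    from uniform_boundedness_nearly_norming [of S "T i" "N i" y "4 ^ n", OF _ _ this]
    show ?thesis using scale T_scale bound by metis
  qed
  then obtain i L v where iLv: "\<And>n::nat. L n > 4 ^ n" "\<And>n. v n \<in> S" "\<And>n. norm (v n) = 1"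
      "\<And>n. norm (T (i n) (v n)) \<ge> 2 / 3 * L n"
      "\<And>n x. x \<in> S \<Longrightarrow> norm (T (i n) x) \<le> L n * norm x"
    by metis
  define s where "s n = (1/3) ^ n *\<^sub>R v n" for n
  have s: "s n \<in> S" "norm (s n) = (1/3) ^ n" "norm (T (i n) (s n)) \<ge> 2 / 3 * L n * (1/3)^n" for n
    using iLv(2-4) [of n] by (auto simp: s_def scale T_scale)
  define step where
    "step n x = (if norm (T (i n) (s n)) \<le> norm (T (i n) (x + s n)) then x + s n else x - s n)" for n x
  have minus: "- x \<in> S" "T j (- x) = - T j x" if "x \<in> S" for x j
    using scale [OF that, of "- 1"] T_scale [OF that, of j "- 1"] by auto
  have step: "step n x \<in> S" "norm (step n x - x) = (1/3)^n"
    "norm (T (i n) (s n)) \<le> norm (T (i n) (step n x))" if "x \<in> S" for n x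
  proof -
    show "step n x \<in> S"
      using that s(1) [of n] add minus by (auto simp: step_def diff_conv_add_uminus simp del: add_uminus_conv_diff)
    show "norm (step n x - x) = (1/3)^n" using s(2) by (simp add: step_def)
    show "norm (T (i n) (s n)) \<le> norm (T (i n) (step n x))"
    proof (cases "norm (T (i n) (s n)) \<le> norm (T (i n) (x + s n))")
      case False
      have "T (i n) (x - s n) = T (i n) x - T (i n) (s n)"
        using T_add [OF that minus(1) [OF s(1)]] minus(2) [OF s(1)] by simp
      moreover have "T (i n) (x + s n) = T (i n) x + T (i n) (s n)"
        using T_add [OF that s(1)] .
      ultimately have "2 *\<^sub>R T (i n) (s n) = T (i n) (x + s n) - T (i n) (x - s n)"
        by (simp add: scaleR_2)
      then have "2 * norm (T (i n) (s n)) \<le> norm (T (i n) (x + s n)) + norm (T (i n) (x - s n))"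
        by (metis abs_numeral norm_scaleR norm_triangle_ineq4)
      then show ?thesis using False by (simp add: step_def)
    qed (simp add: step_def)
  qed
  define X where "X = rec_nat 0 step"
  have X_Suc: "X (Suc n) = step n (X n)" for n by (simp add: X_def)
  have XS: "X n \<in> S" for n
    by (induction n) (simp_all add: X_Suc step(1) zero, simp add: X_def zero)
  have dX: "norm (X (Suc n) - X n) = (1/3)^n" for n
    using step(2) [OF XS] by (simp add: X_Suc)
  \<comment> \<open>The factor \<open>1 - (1/3)^k\<close> comes from the exact partial geometric sum
    and lets the induction close.\<close>
  have tail: "norm (X (n + k) - X n) \<le> (3/2) * (1/3)^n * (1 - (1/3)^k)" for n k
  proof (induction k)
    case (Suc k)
    have "norm (X (n + Suc k) - X n) \<le> norm (X (Suc (n + k)) - X (n + k)) + norm (X (n + k) - X n)"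
      using norm_triangle_ineq [of "X (Suc (n + k)) - X (n + k)" "X (n + k) - X n"] by simp
    then show ?case using Suc dX [of "n + k"] by (simp add: power_add algebra_simps)
  qed simp
  have tail': "norm (X (n + k) - X n) \<le> (3/2) * (1/3)^n" for n k
    using tail [of n k] by (smt (verit) mult_left_le zero_le_power divide_nonneg_nonneg mult_nonneg_nonneg)
  have "Cauchy X"
  proof (rule CauchyI')
    fix e :: real assume "e > 0"
    have "(\<lambda>n. (3/2) * (1/3::real)^n) \<longlonglongrightarrow> (3/2) * 0"
      by (intro tendsto_intros LIMSEQ_realpow_zero) auto
    then have "eventually (\<lambda>n. (3/2) * (1/3::real)^n < e) sequentially"
      using \<open>e > 0\<close> by (intro order_tendstoD) auto
    then obtain m where m: "\<And>n. n \<ge> m \<Longrightarrow> (3/2) * (1/3::real)^n < e"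
      by (auto simp: eventually_sequentially)
    have "dist (X k) (X n) < e" if "k \<ge> m" "n > k" for k n
      using tail' [of k "n - k"] m [OF that(1)] that(2) by (simp add: dist_norm norm_minus_commute)
    then show "\<exists>M. \<forall>m\<ge>M. \<forall>n>m. dist (X m) (X n) < e" by blast
  qed
  then obtain x where x: "X \<longlonglongrightarrow> x"
    using Cauchy_convergent convergent_def by blast
  have xS: "x \<in> S" using closed_sequentially [OF \<open>closed S\<close>] XS x by blast
  have rest: "norm (x - X n) \<le> (3/2) * (1/3)^n" for n
  proof (rule LIMSEQ_le_const2)
    show "(\<lambda>k. norm (X k - X n)) \<longlonglongrightarrow> norm (x - X n)"
      using x by (intro tendsto_intros)
    show "\<exists>N. \<forall>k\<ge>N. norm (X k - X n) \<le> (3/2) * (1/3)^n"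
      using tail' [of n] by (metis le_add_diff_inverse)
  qed
  obtain C where C: "\<And>j. norm (T j x) \<le> C" using pointwise [OF xS] by blast
  \<comment> \<open>Of the gain 2/3 in step \<open>n\<close>, in units of L 3^-n, the later steps
    undo at most 1/3 + 1/9 + ... = 1/2, leaving 1/6.\<close>
  have low: "norm (T (i n) x) \<ge> 1/6 * (4/3)^n" for n
  proof -
    let ?y = "X (Suc n)" and ?T = "T (i n)"
    have "?T ?y + ?T (x - ?y) = ?T x"
      using T_add [OF XS [of "Suc n"] add [OF xS minus(1) [OF XS [of "Suc n"]]]] by simp
    then have "norm (?T x) \<ge> norm (?T ?y) - norm (?T (x - ?y))"
      by (metis norm_diff_ineq)
    moreover have "norm (?T ?y) \<ge> 2 / 3 * L n * (1/3)^n"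
      using step(3) [OF XS, of n n] s(3) [of n] by (simp add: X_Suc)
    moreover have "norm (?T (x - ?y)) \<le> L n * (1/2 * (1/3)^n)"
    proof -
      have "L n \<ge> 0" using iLv(1) [of n] by (meson less_imp_le order_trans zero_le_numeral zero_le_power)
      moreover have "x - ?y \<in> S" using add [OF xS minus(1) [OF XS [of "Suc n"]]] by simp
      moreover have "norm (x - ?y) \<le> 1/2 * (1/3)^n"
        using rest [of "Suc n"] by simp
      ultimately show ?thesis using iLv(5) [of "x - ?y" n]
        by (meson mult_left_mono order_trans)
    qed
    moreover have "L n * (1/3)^n \<ge> 4^n * (1/3)^n"
      using iLv(1) [of n] by (intro mult_right_mono) auto
    moreover have "4^n * (1/3)^n = (4/3::real)^n"
      by (simp add: power_mult_distrib [symmetric])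
    ultimately show ?thesis by simp
  qed
  obtain n where "6 * C < (4/3::real)^n" using real_arch_pow [of "4/3" "6 * C"] by auto
  then show False using low [of n] C [of "i n"] by linarith
qed

section \<open>Operators with numerical range in the upper half plane\<close>

text \<open>The situation of a proof by contradiction: \<open>closed_range\<close> is what is to be
  refuted. \<open>surj_shift\<close> carries the spectral assumption for points below the real axis;
  \<open>Im_nonneg\<close> makes these shifts injective.\<close>

locale upper_half_plane_operator =
  fixes D :: "'h::chilbert_space set" and B :: "'h \<Rightarrow> 'h"
  assumes lin: "linear_operator D B"
    and closed_graph: "closed (graph D B)"
    and Im_nonneg: "\<And>f. f \<in> D \<Longrightarrow> 0 \<le> Im (cinner (B f) f)"
    and surj_shift: "\<And>\<epsilon> y. 0 < \<epsilon> \<Longrightarrow> \<exists>x\<in>D. B x + (\<i> * of_real \<epsilon>) *\<^sub>C x = y"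
    and closed_range: "closed (B ` D)"
begin

lemma
  shows D_zero: "0 \<in> D"
    and D_add: "\<And>x y. x \<in> D \<Longrightarrow> y \<in> D \<Longrightarrow> x + y \<in> D"
    and D_scaleC: "\<And>c x. x \<in> D \<Longrightarrow> c *\<^sub>C x \<in> D"
    and B_add: "\<And>x y. x \<in> D \<Longrightarrow> y \<in> D \<Longrightarrow> B (x + y) = B x + B y"
    and B_scaleC: "\<And>c x. x \<in> D \<Longrightarrow> B (c *\<^sub>C x) = c *\<^sub>C B x"
  using lin by (auto simp: linear_operator_def complex_subspace_def)

lemma D_diff: "x \<in> D \<Longrightarrow> y \<in> D \<Longrightarrow> x - y \<in> D"
  using D_add [of x "- y"] D_scaleC [of y "- 1"] by (simp add: scaleC_minus_one)

lemma B_diff: "x \<in> D \<Longrightarrow> y \<in> D \<Longrightarrow> B (x - y) = B x - B y"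
  using B_add [of x "- y"] B_scaleC [of y "- 1"] D_scaleC [of y "- 1"]
  by (simp add: scaleC_minus_one)

lemma D_scaleR: "x \<in> D \<Longrightarrow> r *\<^sub>R x \<in> D"
  by (simp add: scaleR_scaleC D_scaleC)

lemma B_scaleR: "x \<in> D \<Longrightarrow> B (r *\<^sub>R x) = r *\<^sub>R B x"
  by (simp add: scaleR_scaleC B_scaleC)

lemma B_zero: "B 0 = 0"
  using B_scaleC [OF D_zero, of 0] by simp

lemma cinner_B_expand:
  assumes "f \<in> D" "g \<in> D"
  shows "cinner (B (f + c *\<^sub>C g)) (f + c *\<^sub>C g) =
    cinner (B f) f + c * cinner (B g) f + cnj c * cinner (B f) g + c * cnj c * cinner (B g) g"
  using assms D_scaleC [OF assms(2), of c]
  by (simp add: B_add B_scaleC cinner_add_left cinner_add_right cinner_scaleC_left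
      cinner_scaleC_right algebra_simps)

text \<open>Working with the form \<open>(\<langle>Bf,g\<rangle> - \<langle>f,Bg\<rangle>) / 2i\<close> on \<open>D\<close> in place of the operator
  \<open>(B - B\<^sup>*) / 2i\<close> avoids the adjoint.\<close>
lemma imaginary_form_Cauchy_Schwarz:
  assumes "f \<in> D" "g \<in> D"
  shows "(norm (cinner (B f) g - cnj (cinner (B g) f)))\<^sup>2
    \<le> 4 * Im (cinner (B f) f) * Im (cinner (B g) g)"
proof -
  \<comment> \<open>\<open>w\<close> is the value of the form at the pair \<open>g\<close>,
    \<open>f\<close>, so that \<open>2 * Re (c * w)\<close> is the cross term of Im <Bh,h> for h = f
    + cg.\<close>
  define w where "w = (cinner (B g) f - cnj (cinner (B f) g)) / (2 * \<i>)"
  have w: "2 * Re w = Im (cinner (B g) f) + Im (cinner (B f) g)"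
      "2 * Im w = Re (cinner (B f) g) - Re (cinner (B g) f)"
    by (simp_all add: w_def Re_divide Im_divide field_simps)
  have "(norm w)\<^sup>2 \<le> Im (cinner (B f) f) * Im (cinner (B g) g)"
  proof (rule nonneg_hermitian_discriminant)
    fix c
    have "2 * Re (c * w) = Re c * (2 * Re w) - Im c * (2 * Im w)" by simp
    then have "Im (cinner (B (f + c *\<^sub>C g)) (f + c *\<^sub>C g)) =
        Im (cinner (B f) f) + 2 * Re (c * w) + (norm c)\<^sup>2 * Im (cinner (B g) g)"
      unfolding cmod_power2 w by (simp add: cinner_B_expand [OF assms] power2_eq_square algebra_simps)
    then show "0 \<le> Im (cinner (B f) f) + 2 * Re (c * w) + (norm c)\<^sup>2 * Im (cinner (B g) g)"
      using Im_nonneg [OF D_add [OF assms(1) D_scaleC [OF assms(2)]], of c] by simp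
  qed (rule Im_nonneg [OF assms(2)])
  moreover have "norm (cinner (B f) g - cnj (cinner (B g) f)) = 2 * norm w"
  proof -
    have "cinner (B f) g - cnj (cinner (B g) f) = - cnj (cinner (B g) f - cnj (cinner (B f) g))"
      by simp
    then have "norm (cinner (B f) g - cnj (cinner (B g) f)) = norm (cinner (B g) f - cnj (cinner (B f) g))"
      by (metis complex_mod_cnj norm_minus_cancel)
    then show ?thesis by (simp add: w_def norm_divide norm_mult)
  qed
  ultimately show ?thesis by (simp add: power_mult_distrib)
qed

text \<open>As Im <Bu,u> = 0, the right side of Cauchy-Schwarz vanishes, and <Bg,u> = <g,Bu> =
  0.\<close>

lemma kernel_orthogonal_range:
  assumes "u \<in> D" "B u = 0" "g \<in> D"
  shows "cinner (B g) u = 0"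
  using imaginary_form_Cauchy_Schwarz [OF assms(1,3)] assms(2) by simp

section \<open>Resolvents of \<open>B\<close> on the negative imaginary axis\<close>

text \<open>After pairing with \<open>x\<close>, the shift adds eps |x|^2 to an imaginary part that
  is already nonnegative. Injectivity and the resolvent bound 1/eps both follow.\<close>

lemma norm_le_shift:
  assumes "0 < \<epsilon>" "x \<in> D"
  shows "\<epsilon> * norm x \<le> norm (B x + (\<i> * of_real \<epsilon>) *\<^sub>C x)"
proof (cases "x = 0")
  case False
  have "Im (cinner (B x + (\<i> * of_real \<epsilon>) *\<^sub>C x) x) = Im (cinner (B x) x) + \<epsilon> * (norm x)\<^sup>2"
    by (simp add: cinner_add_left cinner_scaleC_left cinner_self)
  then have "\<epsilon> * (norm x)\<^sup>2 \<le> Im (cinner (B x + (\<i> * of_real \<epsilon>) *\<^sub>C x) x)"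
    using Im_nonneg [OF assms(2)] by simp
  also have "\<dots> \<le> norm (B x + (\<i> * of_real \<epsilon>) *\<^sub>C x) * norm x"
    using abs_Im_le_cmod norm_cinner_le by (meson abs_le_D1 order_trans)
  finally show ?thesis using False by (simp add: power2_eq_square)
qed simp

lemma inj_shift:
  assumes "0 < \<epsilon>" "x \<in> D" "y \<in> D"
    and "B x + (\<i> * of_real \<epsilon>) *\<^sub>C x = B y + (\<i> * of_real \<epsilon>) *\<^sub>C y"
  shows "x = y"
proof -
  have "B (x - y) + (\<i> * of_real \<epsilon>) *\<^sub>C (x - y) = 0"
    using assms by (simp add: B_diff scaleC_diff_right algebra_simps)
  then have "\<epsilon> * norm (x - y) \<le> 0"
    using norm_le_shift [OF assms(1) D_diff [OF assms(2,3)]] by simp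
  then show ?thesis using \<open>0 < \<epsilon>\<close> by (simp add: mult_le_0_iff)
qed

text \<open>The resolvent (B + i eps)^-1. For positive \<open>\<epsilon>\<close> the choice is
  unique by \<open>inj_shift\<close>, so identities for \<open>res\<close> reduce through
  \<open>res_eqI\<close> to exhibiting a preimage in \<open>D\<close>.\<close>

definition res :: "real \<Rightarrow> 'h \<Rightarrow> 'h" where
  "res \<epsilon> y = (SOME x. x \<in> D \<and> B x + (\<i> * of_real \<epsilon>) *\<^sub>C x = y)"

lemma
  assumes "0 < \<epsilon>"
  shows res_D: "res \<epsilon> y \<in> D"
    and B_res: "B (res \<epsilon> y) + (\<i> * of_real \<epsilon>) *\<^sub>C res \<epsilon> y = y"
proof -
  have "res \<epsilon> y \<in> D \<and> B (res \<epsilon> y) + (\<i> * of_real \<epsilon>) *\<^sub>C res \<epsilon> y = y"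
    unfolding res_def by (rule someI_ex) (use surj_shift [OF assms, of y] in blast)
  then show "res \<epsilon> y \<in> D" "B (res \<epsilon> y) + (\<i> * of_real \<epsilon>) *\<^sub>C res \<epsilon> y = y" by auto
qed

lemma res_eqI:
  "0 < \<epsilon> \<Longrightarrow> x \<in> D \<Longrightarrow> B x + (\<i> * of_real \<epsilon>) *\<^sub>C x = y \<Longrightarrow> res \<epsilon> y = x"
  using inj_shift [OF _ res_D] B_res by blast

lemma res_add: "0 < \<epsilon> \<Longrightarrow> res \<epsilon> (x + y) = res \<epsilon> x + res \<epsilon> y"
  using B_res [of \<epsilon> x] B_res [of \<epsilon> y]
  by (intro res_eqI) (auto simp: res_D D_add B_add scaleC_add_right algebra_simps)

lemma res_scaleC:
  assumes "0 < \<epsilon>"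
  shows "res \<epsilon> (c *\<^sub>C x) = c *\<^sub>C res \<epsilon> x"
proof (rule res_eqI [OF assms])
  have "B (c *\<^sub>C res \<epsilon> x) + (\<i> * of_real \<epsilon>) *\<^sub>C c *\<^sub>C res \<epsilon> x =
      c *\<^sub>C (B (res \<epsilon> x) + (\<i> * of_real \<epsilon>) *\<^sub>C res \<epsilon> x)"
    using assms by (simp add: res_D B_scaleC scaleC_scaleC scaleC_add_right mult.commute)
  then show "B (c *\<^sub>C res \<epsilon> x) + (\<i> * of_real \<epsilon>) *\<^sub>C c *\<^sub>C res \<epsilon> x = c *\<^sub>C x"
    using B_res [OF assms] by simp
qed (simp add: assms D_scaleC res_D)

lemma res_scaleR: "0 < \<epsilon> \<Longrightarrow> res \<epsilon> (r *\<^sub>R x) = r *\<^sub>R res \<epsilon> x"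
  by (simp add: scaleR_scaleC res_scaleC)

lemma norm_res_le: "0 < \<epsilon> \<Longrightarrow> norm (res \<epsilon> y) \<le> 1 / \<epsilon> * norm y"
  using norm_le_shift [OF _ res_D, of \<epsilon> \<epsilon> y] B_res [of \<epsilon> y] by (simp add: field_simps)

text \<open>The first form stays bounded as eps tends to 0. The second shows that \<open>res\<close>
  maps the range of \<open>B\<close> into itself, so bounds on the range can be iterated.\<close>

lemma res_B:
  assumes "0 < \<epsilon>" "g \<in> D"
  shows "res \<epsilon> (B g) = g - (\<i> * of_real \<epsilon>) *\<^sub>C res \<epsilon> g"
    and "res \<epsilon> (B g) = B (res \<epsilon> g)"
proof -
  show "res \<epsilon> (B g) = g - (\<i> * of_real \<epsilon>) *\<^sub>C res \<epsilon> g"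
  proof (rule res_eqI [OF assms(1)])
    show "g - (\<i> * of_real \<epsilon>) *\<^sub>C res \<epsilon> g \<in> D"
      using assms by (simp add: D_diff D_scaleC res_D)
    have "B (g - (\<i> * of_real \<epsilon>) *\<^sub>C res \<epsilon> g) + (\<i> * of_real \<epsilon>) *\<^sub>C (g - (\<i> * of_real \<epsilon>) *\<^sub>C res \<epsilon> g) =
        B g + (\<i> * of_real \<epsilon>) *\<^sub>C g - (\<i> * of_real \<epsilon>) *\<^sub>C (B (res \<epsilon> g) + (\<i> * of_real \<epsilon>) *\<^sub>C res \<epsilon> g)"
      using assms by (simp add: B_diff B_scaleC D_scaleC res_D scaleC_diff_right scaleC_add_right)
    then show "B (g - (\<i> * of_real \<epsilon>) *\<^sub>C res \<epsilon> g) + (\<i> * of_real \<epsilon>) *\<^sub>C (g - (\<i> * of_real \<epsilon>) *\<^sub>C res \<epsilon> g) = B g"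
      using B_res [OF assms(1), of g] by simp
  qed
  then show "res \<epsilon> (B g) = B (res \<epsilon> g)"
    using B_res [OF assms(1), of g] by (metis add_diff_cancel_right')
qed

lemma range_add: "x \<in> B ` D \<Longrightarrow> y \<in> B ` D \<Longrightarrow> x + y \<in> B ` D"
  by (auto simp: B_add [symmetric] D_add)

lemma range_scaleR: "x \<in> B ` D \<Longrightarrow> r *\<^sub>R x \<in> B ` D"
  by (auto simp: B_scaleR [symmetric] D_scaleR)

text \<open>On the range the resolvents are pointwise bounded as \<open>\<epsilon> \<rightarrow> 0\<close>, because
  \<open>res \<epsilon> (B g) = g - i\<epsilon> res \<epsilon> g\<close> and \<open>\<epsilon> res \<epsilon>\<close> is a contraction.\<close>
lemma res_uniformly_bounded:
  obtains M where "\<And>\<epsilon> y. 0 < \<epsilon> \<Longrightarrow> y \<in> B ` D \<Longrightarrow> norm (res \<epsilon> y) \<le> M * norm y"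
proof -
  \<comment> \<open>\<open>exp t\<close> lets a whole type index the positive shifts, as
    \<open>uniform_boundedness_on\<close> puts no side condition on its index.\<close>
  have "\<exists>M. \<forall>t. \<forall>x\<in>B ` D. norm (res (exp t) x) \<le> M * norm x"
  proof (rule uniform_boundedness_on [where N = "\<lambda>t. 1 / exp t"])
    fix y assume "y \<in> B ` D"
    then obtain g where g: "g \<in> D" "y = B g" by blast
    have "norm (res (exp t) y) \<le> 2 * norm g" for t
    proof -
      have "norm (res (exp t) y) \<le> norm g + norm ((\<i> * of_real (exp t)) *\<^sub>C res (exp t) g)"
        unfolding g(2) res_B(1) [OF exp_gt_zero g(1)] by (rule norm_triangle_ineq4)
      also have "\<dots> = norm g + exp t * norm (res (exp t) g)"
        by (simp add: norm_scaleC norm_mult)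
      also have "\<dots> \<le> 2 * norm g"
        using norm_res_le [of "exp t" g] by (simp add: field_simps)
      finally show ?thesis .
    qed
    then show "\<exists>C. \<forall>t. norm (res (exp t) y) \<le> C" by blast
  next
    show "0 \<in> B ` D" using D_zero B_zero by force
  next
    show "norm (res (exp t) x) \<le> 1 / exp t * norm x" for t x
      by (rule norm_res_le) simp
  qed (simp_all add: closed_range range_add range_scaleR res_add res_scaleR)
  then obtain M where M: "\<And>t x. x \<in> B ` D \<Longrightarrow> norm (res (exp t) x) \<le> M * norm x" by blast
  show ?thesis
    using M [of _ "ln _"] by (intro that [of M]) (metis exp_ln)
qed

section \<open>Inverting \<open>B\<close> on its range and splitting off the kernel\<close>

text \<open>On the range the resolvent identity makes \<open>res\<close> Lipschitz in eps, so it
  converges as eps tends to 0. The closed graph shows that the limit solves the equation, and the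
  closed range contains it.\<close>

lemma bounded_right_inverse:
  obtains M where "1 \<le> M" "\<And>y. y \<in> B ` D \<Longrightarrow> \<exists>v \<in> D \<inter> B ` D. B v = y \<and> norm v \<le> M * norm y"
proof -
  obtain M0 where M0: "\<And>\<epsilon> y. 0 < \<epsilon> \<Longrightarrow> y \<in> B ` D \<Longrightarrow> norm (res \<epsilon> y) \<le> M0 * norm y"
    using res_uniformly_bounded by blast
  define M where "M = max 1 M0"
  have M: "norm (res \<epsilon> y) \<le> M * norm y" if "0 < \<epsilon>" "y \<in> B ` D" for \<epsilon> y
    using M0 [OF that] by (smt (verit) M_def mult_right_mono norm_ge_zero)
  have "\<exists>v \<in> D \<inter> B ` D. B v = y \<and> norm v \<le> M * norm y" if y: "y \<in> B ` D" for y
  proof -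
    have res_range: "res \<epsilon> y \<in> B ` D" if "0 < \<epsilon>" for \<epsilon>
      using y that by (auto simp: res_B(2) res_D)
    \<comment> \<open>Resolvent identity; \<open>M\<close> enters twice because
      \<open>res \<delta> y\<close> is again in the range.\<close>
    have res_diff: "norm (res \<epsilon> y - res \<delta> y) \<le> \<bar>\<delta> - \<epsilon>\<bar> * (M * (M * norm y))" if "0 < \<epsilon>" "0 < \<delta>" for \<epsilon> \<delta>
    proof -
      have "res \<delta> y = res \<epsilon> (B (res \<delta> y) + (\<i> * of_real \<epsilon>) *\<^sub>C res \<delta> y)"
        using res_eqI [OF that(1) res_D [OF that(2)]] by simp
      moreover have "B (res \<delta> y) + (\<i> * of_real \<epsilon>) *\<^sub>C res \<delta> y = y + (\<i> * of_real (\<epsilon> - \<delta>)) *\<^sub>C res \<delta> y"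
        using B_res [OF that(2), of y] by (simp add: algebra_simps scaleC_diff_left)
      ultimately have "res \<delta> y = res \<epsilon> y + (\<i> * of_real (\<epsilon> - \<delta>)) *\<^sub>C res \<epsilon> (res \<delta> y)"
        using that by (simp add: res_add res_scaleC)
      then have "res \<delta> y - res \<epsilon> y = (\<i> * of_real (\<epsilon> - \<delta>)) *\<^sub>C res \<epsilon> (res \<delta> y)"
        by (metis add_diff_cancel_left')
      then have "norm (res \<delta> y - res \<epsilon> y) = \<bar>\<epsilon> - \<delta>\<bar> * norm (res \<epsilon> (res \<delta> y))"
        by (simp only: norm_scaleC norm_mult norm_ii norm_of_real mult_1)
      then have "norm (res \<epsilon> y - res \<delta> y) = \<bar>\<delta> - \<epsilon>\<bar> * norm (res \<epsilon> (res \<delta> y))"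
        by (simp only: norm_minus_commute abs_minus_commute)
      also have "\<dots> \<le> \<bar>\<delta> - \<epsilon>\<bar> * (M * (M * norm y))"
        using M [OF that(1) res_range [OF that(2)]] M [OF that(2) y]
        by (intro mult_left_mono order_trans [OF M [OF that(1) res_range [OF that(2)]]]) (auto simp: M_def)
      finally show ?thesis .
    qed
    define e where "e n = inverse (real (Suc n))" for n
    have e: "0 < e n" for n by (simp add: e_def)
    have e0: "e \<longlonglongrightarrow> 0" unfolding e_def by (rule LIMSEQ_inverse_real_of_nat)
    define X where "X n = res (e n) y" for n
    have "Cauchy X"
    proof (rule metric_CauchyI)
      fix r :: real assume "r > 0"
      define C where "C = M * (M * norm y) + 1"
      have C: "0 < C" by (simp add: C_def M_def add_nonneg_pos)
      have "Cauchy e" using e0 LIMSEQ_imp_Cauchy by blast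
      then obtain N where N: "\<And>m n. m \<ge> N \<Longrightarrow> n \<ge> N \<Longrightarrow> dist (e m) (e n) < r / C"
        using \<open>r > 0\<close> C by (meson Cauchy_def divide_pos_pos)
      have "dist (X m) (X n) < r" if "m \<ge> N" "n \<ge> N" for m n
      proof -
        have "dist (X m) (X n) \<le> \<bar>e n - e m\<bar> * (M * (M * norm y))"
          using res_diff [OF e e] by (simp add: X_def dist_norm)
        also have "\<dots> \<le> \<bar>e n - e m\<bar> * C"
          by (intro mult_left_mono) (auto simp: C_def)
        also have "\<dots> < r"
          using N [OF that] C by (simp add: dist_real_def abs_minus_commute pos_less_divide_eq)
        finally show ?thesis .
      qed
      then show "\<exists>M. \<forall>m\<ge>M. \<forall>n\<ge>M. dist (X m) (X n) < r" by blast
    qed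
    then obtain v where v: "X \<longlonglongrightarrow> v"
      using Cauchy_convergent convergent_def by blast
    have "(\<lambda>n. norm ((\<i> * of_real (e n)) *\<^sub>C X n)) \<longlonglongrightarrow> norm (\<i> * of_real 0) * norm v"
      unfolding norm_scaleC by (intro tendsto_intros e0 v)
    then have "(\<lambda>n. norm ((\<i> * of_real (e n)) *\<^sub>C X n)) \<longlonglongrightarrow> 0"
      by simp
    then have "(\<lambda>n. (\<i> * of_real (e n)) *\<^sub>C X n) \<longlonglongrightarrow> 0"
      by (rule tendsto_norm_zero_cancel)
    then have "(\<lambda>n. y - (\<i> * of_real (e n)) *\<^sub>C X n) \<longlonglongrightarrow> y - 0"
      by (intro tendsto_intros)
    moreover have "B (X n) = y - (\<i> * of_real (e n)) *\<^sub>C X n" for n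
      using B_res [OF e, of n y] by (simp add: X_def algebra_simps)
    ultimately have "(\<lambda>n. (X n, B (X n))) \<longlonglongrightarrow> (v, y)"
      using v by (auto intro!: tendsto_Pair)
    moreover have "(X n, B (X n)) \<in> graph D B" for n
      by (auto simp: graph_def X_def res_D e)
    ultimately have "(v, y) \<in> graph D B"
      by (rule closed_sequentially [OF closed_graph, rotated])
    then have "v \<in> D" "B v = y" by (auto simp: graph_def)
    moreover have "v \<in> B ` D"
      using closed_sequentially [OF closed_range _ v] res_range e by (auto simp: X_def)
    moreover have "norm v \<le> M * norm y"
      using LIMSEQ_le_const2 [OF tendsto_norm [OF v]] M [OF e y] by (auto simp: X_def)
    ultimately show ?thesis by blast
  qed
  then show ?thesis using that [of M] by (simp add: M_def)
qed

lemma kernel_range_decomposition: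
  assumes "x \<in> D"
  obtains u v where "u \<in> D" "B u = 0" "v \<in> D" "v \<in> B ` D" "x = u + v"
proof -
  obtain v where "v \<in> D" "v \<in> B ` D" "B v = B x"
    using bounded_right_inverse assms by (metis IntE imageI)
  then show ?thesis
    using that [of "x - v" v] assms by (simp add: D_diff B_diff)
qed

text \<open>\<open>u\<close> is orthogonal to \<open>v\<close> and \<open>B v\<close>, which both
  lie in the range. Adding a kernel vector thus moves the normalised value towards 0 along its
  ray.\<close>

lemma kernel_add_cinner:
  assumes "u \<in> D" "B u = 0" "v \<in> D" "v \<in> B ` D"
  shows "cinner (B (u + v)) (u + v) = cinner (B v) v"
    and "(norm (u + v))\<^sup>2 = (norm u)\<^sup>2 + (norm v)\<^sup>2"
proof -
  show "cinner (B (u + v)) (u + v) = cinner (B v) v"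
    using assms kernel_orthogonal_range [OF assms(1-3)] by (simp add: B_add cinner_add_right)
  have "cinner v u = 0" using assms kernel_orthogonal_range [OF assms(1,2)] by auto
  then have "cinner (u + v) (u + v) = cinner u u + cinner v v"
    using cinner_commute [of u v] by (simp add: cinner_add_left cinner_add_right)
  then show "(norm (u + v))\<^sup>2 = (norm u)\<^sup>2 + (norm v)\<^sup>2"
    unfolding cinner_self by (metis of_real_add of_real_eq_iff)
qed

text \<open>Here \<open>\<sigma> = \<plusminus>1\<close> selects the side on which the curvature is infinite, and \<open>curved\<close> is the
  inequality \<open>K \<xi>\<^sup>2 \<le> \<eta>\<close> near the origin, made homogeneous in \<open>f\<close>.\<close>
lemma infinite_curvature_contradiction:
  assumes \<sigma>: "\<sigma> = 1 \<or> \<sigma> = (- 1 :: real)"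
    and curved: "\<And>K. \<exists>\<delta>>0. \<forall>h\<in>D. 0 < \<sigma> * Re (cinner (B h) h) \<longrightarrow>
      \<sigma> * Re (cinner (B h) h) \<le> \<delta> * (norm h)\<^sup>2 \<longrightarrow>
      K * (Re (cinner (B h) h))\<^sup>2 \<le> Im (cinner (B h) h) * (norm h)\<^sup>2"
    and tangent: "\<And>\<tau>. 0 < \<tau> \<Longrightarrow> \<exists>f\<in>D. 0 < \<sigma> * Re (cinner (B f) f) \<and>
      Im (cinner (B f) f) < \<tau> * (\<sigma> * Re (cinner (B f) f))"
    and closure: "\<And>r. 0 < r \<Longrightarrow> \<exists>f\<in>D. norm f = 1 \<and> norm (cinner (B f) f) \<le> r"
  shows False
proof -
  have \<sigma>2: "\<sigma> * \<sigma> = 1" using \<sigma> by auto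
  \<comment> \<open>\<open>closure\<close> may return vectors with a nonzero kernel component, and
    these are not in the range.\<close>
  have approx: "\<exists>f\<in>D \<inter> B ` D. norm f = 1 \<and> norm (cinner (B f) f) \<le> r" if "0 < r" for r
  proof (cases "\<exists>u\<in>D. B u = 0 \<and> u \<noteq> 0")
    case False
    then have "x \<in> B ` D" if "x \<in> D" for x
      using kernel_range_decomposition [OF that] by (metis add_0)
    then show ?thesis using closure [OF that] by blast
  next
    case True
    then obtain u0 where u0: "u0 \<in> D" "B u0 = 0" "u0 \<noteq> 0" by blast
    obtain \<delta> where \<delta>: "\<delta> > 0" and curv: "\<And>h. h \<in> D \<Longrightarrow> 0 < \<sigma> * Re (cinner (B h) h) \<Longrightarrow>
      \<sigma> * Re (cinner (B h) h) \<le> \<delta> * (norm h)\<^sup>2 \<Longrightarrow>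
      1 * (Re (cinner (B h) h))\<^sup>2 \<le> Im (cinner (B h) h) * (norm h)\<^sup>2"
      using curved [of 1] by blast
    \<comment> \<open>\<open>r / 2\<close> because the point found will satisfy
      \<open>\<eta> \<le> \<xi> \<le> d\<close>. The slope bound \<open>min d 1\<close> below yields
      the first inequality, and for the second it conflicts with curvature 1 at abscissa
      \<open>d\<close>.\<close>
    define d where "d = min \<delta> (r / 2)"
    have d: "0 < d" "d \<le> \<delta>" "2 * d \<le> r" using \<delta> that by (auto simp: d_def)
    obtain x where x: "x \<in> D" "0 < \<sigma> * Re (cinner (B x) x)"
      "Im (cinner (B x) x) < min d 1 * (\<sigma> * Re (cinner (B x) x))"
      using tangent [of "min d 1"] d by auto
    obtain u v0 where uv: "u \<in> D" "B u = 0" "v0 \<in> D" "v0 \<in> B ` D" "x = u + v0"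
      using kernel_range_decomposition [OF x(1)] by blast
    have xv: "cinner (B x) x = cinner (B v0) v0"
      using kernel_add_cinner(1) [OF uv(1-4)] uv(5) by simp
    have "v0 \<noteq> 0" using x(2) xv by auto
    define v where "v = (1 / norm v0) *\<^sub>R v0"
    have v: "v \<in> D" "v \<in> B ` D" "norm v = 1"
      using uv \<open>v0 \<noteq> 0\<close> by (simp_all add: v_def D_scaleR range_scaleR)
    have vz: "cinner (B v) v = of_real ((1 / norm v0)\<^sup>2) * cinner (B x) x"
      using uv(3) xv by (simp add: v_def scaleR_scaleC B_scaleC cinner_scaleC_left cinner_scaleC_right power2_eq_square)
    define \<xi> \<eta> where "\<xi> = \<sigma> * Re (cinner (B v) v)" and "\<eta> = Im (cinner (B v) v)"
    have pos: "0 < (1 / norm v0)\<^sup>2" using \<open>v0 \<noteq> 0\<close> by simp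
    have \<xi>_pos: "0 < \<xi>"
      using mult_pos_pos [OF pos x(2)] by (simp add: \<xi>_def vz mult.left_commute)
    have \<eta>_less: "\<eta> < min d 1 * \<xi>"
      using mult_strict_left_mono [OF x(3) pos] by (simp add: \<xi>_def \<eta>_def vz mult.left_commute)
    have \<eta>_nonneg: "0 \<le> \<eta>" using Im_nonneg [OF v(1)] by (simp add: \<eta>_def)
    have Re_v: "\<bar>Re (cinner (B v) v)\<bar> = \<xi>" "(Re (cinner (B v) v))\<^sup>2 = \<xi>\<^sup>2"
      using \<sigma> \<xi>_pos by (auto simp: \<xi>_def)
    have "\<xi> \<le> d"
    proof (rule ccontr)
      \<comment> \<open>adding a kernel vector scales the value \<open>\<xi> + i\<eta>\<close> down to the range where \<open>curv\<close> applies\<close>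
      assume "\<not> \<xi> \<le> d"
      then have ge1: "1 \<le> \<xi> / d" using d by simp
      \<comment> \<open>This length makes |h|^2 equal to \<open>\<xi> / d\<close>, so the normalised
        value of \<open>h\<close> has abscissa \<open>d\<close> up to the sign
        \<open>\<sigma>\<close>.\<close>
      define u where "u = (sqrt (\<xi> / d - 1) / norm u0) *\<^sub>R u0"
      have u: "u \<in> D" "B u = 0" "(norm u)\<^sup>2 = \<xi> / d - 1"
        using u0 ge1 by (simp_all add: u_def D_scaleR B_scaleR)
      define h where "h = u + v"
      have h: "h \<in> D" "(norm h)\<^sup>2 = \<xi> / d" "cinner (B h) h = cinner (B v) v"
        using kernel_add_cinner [OF u(1,2) v(1,2)] u v by (simp_all add: h_def D_add)
      have "\<xi> \<le> \<delta> * (\<xi> / d)"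
        using d \<xi>_pos by (simp add: field_simps)
      then have "\<xi>\<^sup>2 \<le> \<eta> * (\<xi> / d)"
        using curv [OF h(1)] \<xi>_pos unfolding h(2,3) Re_v \<eta>_def [symmetric] \<xi>_def [symmetric] by simp
      then have "d * \<xi> \<le> \<eta>"
        using d \<xi>_pos by (simp add: field_simps power2_eq_square)
      moreover have "min d 1 * \<xi> \<le> d * \<xi>"
        using \<xi>_pos by (intro mult_right_mono) auto
      ultimately show False using \<eta>_less by linarith
    qed
    moreover have "min d 1 * \<xi> \<le> \<xi>"
      using mult_right_mono [of "min d 1" 1 \<xi>] \<xi>_pos by simp
    ultimately have "\<xi> + \<eta> \<le> r" using \<eta>_less d by linarith
    then have "norm (cinner (B v) v) \<le> r"
      using cmod_le [of "cinner (B v) v"] \<eta>_nonneg by (simp add: Re_v \<eta>_def)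
    then show ?thesis using v by blast
  qed
  obtain M where M: "1 \<le> M" and inv: "\<And>y. y \<in> B ` D \<Longrightarrow> \<exists>v \<in> D \<inter> B ` D. B v = y \<and> norm v \<le> M * norm y"
    using bounded_right_inverse by blast
  \<comment> \<open>\<open>8 * M + 1\<close> is just too much for the vector \<open>h\<close> built
    below, which has \<eta> |h|^2 <= 4 M t^2 * 2 and \<xi> >= t.\<close>
  obtain \<delta> where \<delta>: "\<delta> > 0" and curv: "\<And>h. h \<in> D \<Longrightarrow> 0 < \<sigma> * Re (cinner (B h) h) \<Longrightarrow>
      \<sigma> * Re (cinner (B h) h) \<le> \<delta> * (norm h)\<^sup>2 \<Longrightarrow>
      (8 * M + 1) * (Re (cinner (B h) h))\<^sup>2 \<le> Im (cinner (B h) h) * (norm h)\<^sup>2"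
    using curved [of "8 * M + 1"] by blast
  \<comment> \<open>The first bound keeps |tg| below 1/4 and the errors 4 M t^2 below t; the second
    serves \<xi> <= 3t with |h|^2 >= 1/2.\<close>
  define t where "t = min (1 / (4 * M)) (\<delta> / 6)"
  have t: "0 < t" "4 * M * t \<le> 1" "6 * t \<le> \<delta>"
    using M \<delta> by (auto simp: t_def min_def field_simps)
  obtain f where f: "f \<in> D" "f \<in> B ` D" "norm f = 1" and z: "norm (cinner (B f) f) \<le> t\<^sup>2"
    using approx [of "t\<^sup>2"] t by auto
  obtain g where g: "g \<in> D" "B g = f" "norm g \<le> M"
    using inv [OF f(2)] f(3) by auto
  define X where "X = cinner (B f) g"
  define b where "b = cinner (B g) g"
  have b: "norm b \<le> M"
    using norm_cinner_le [of f g] f(3) g(2,3) by (simp add: b_def)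
  have X: "norm (X - 1) \<le> 2 * M * t"
  proof -
    have "(norm (X - 1))\<^sup>2 \<le> 4 * Im (cinner (B f) f) * Im b"
      using imaginary_form_Cauchy_Schwarz [OF f(1) g(1)] f(3) g(2) by (simp add: X_def b_def cinner_self)
    also have "\<dots> \<le> 4 * t\<^sup>2 * M"
      using z b abs_Im_le_cmod [of "cinner (B f) f"] abs_Im_le_cmod [of b] Im_nonneg [OF f(1)] Im_nonneg [OF g(1)]
      by (intro mult_mono) (auto simp: b_def)
    also have "\<dots> \<le> (2 * M * t)\<^sup>2"
      using M t mult_left_mono [of 1 M "4 * t\<^sup>2 * M"] by (simp add: power2_eq_square algebra_simps)
    finally show ?thesis
      by (rule power2_le_imp_le) (use M t in auto)
  qed
  \<comment> \<open>For a real coefficient the two cross terms, both close to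
    \<open>\<sigma> * t\<close>, add up, while their imaginary part is only of order t^2.\<close>
  define h where "h = f + of_real (\<sigma> * t) *\<^sub>C g"
  have h: "h \<in> D" using f g by (simp add: h_def D_add D_scaleC)
  have eh: "cinner (B h) h = cinner (B f) f + of_real (\<sigma> * t) * (1 + X) + of_real (t\<^sup>2) * b"
  proof -
    have "complex_of_real \<sigma> * complex_of_real \<sigma> = 1"
      using \<sigma>2 by (metis of_real_1 of_real_mult)
    then have "of_real (\<sigma> * t) * cnj (of_real (\<sigma> * t)) = complex_of_real (t\<^sup>2)"
      by (simp add: power2_eq_square algebra_simps)
    then show ?thesis
      unfolding h_def cinner_B_expand [OF f(1) g(1)] using f(3) g(2)
      by (simp add: X_def b_def cinner_self algebra_simps)
  qed
  have tM: "norm (of_real (\<sigma> * t) *\<^sub>C g) \<le> 1 / 4"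
  proof -
    have "norm (of_real (\<sigma> * t) *\<^sub>C g) = t * norm g"
      using \<sigma> t by (auto simp: norm_scaleC norm_mult)
    also have "\<dots> \<le> t * M" using t g(3) by (intro mult_left_mono) auto
    also have "\<dots> \<le> 1 / 4" using t(2) by (simp add: field_simps)
    finally show ?thesis .
  qed
  have "norm h \<le> 5 / 4" using norm_triangle_ineq [of f "of_real (\<sigma> * t) *\<^sub>C g"] f(3) tM by (simp add: h_def)
  then have h_upper: "(norm h)\<^sup>2 \<le> 2"
    using power_mono [of "norm h" "5/4" 2] by (simp add: power2_eq_square)
  have "3 / 4 \<le> norm h" using norm_diff_ineq [of f "of_real (\<sigma> * t) *\<^sub>C g"] f(3) tM by (simp add: h_def)
  then have h_lower: "1 / 2 \<le> (norm h)\<^sup>2"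
    using power_mono [of "3/4" "norm h" 2] by (simp add: power2_eq_square)
  have t2: "t\<^sup>2 \<le> M * t\<^sup>2" using M by (simp add: mult_le_cancel_right1)
  have tX: "\<bar>t * Re (X - 1)\<bar> \<le> 2 * (M * t\<^sup>2)" "\<bar>t * Im (X - 1)\<bar> \<le> 2 * (M * t\<^sup>2)"
  proof -
    have *: "t * norm (X - 1) \<le> 2 * (M * t\<^sup>2)"
      using mult_left_mono [OF X, of t] t by (simp add: power2_eq_square algebra_simps)
    show "\<bar>t * Re (X - 1)\<bar> \<le> 2 * (M * t\<^sup>2)" "\<bar>t * Im (X - 1)\<bar> \<le> 2 * (M * t\<^sup>2)"
      unfolding abs_mult abs_of_pos [OF t(1)]
      using * t mult_left_mono [OF abs_Re_le_cmod, of t "X - 1"] mult_left_mono [OF abs_Im_le_cmod, of t "X - 1"]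
      by linarith+
  qed
  have tb: "\<bar>t\<^sup>2 * Re b\<bar> \<le> M * t\<^sup>2" "\<bar>t\<^sup>2 * Im b\<bar> \<le> M * t\<^sup>2"
    using b abs_Re_le_cmod [of b] abs_Im_le_cmod [of b]
    by (auto simp: abs_mult mult.commute [of M] intro!: mult_left_mono)
  have zb: "\<bar>Re (cinner (B f) f)\<bar> \<le> t\<^sup>2" "\<bar>Im (cinner (B f) f)\<bar> \<le> t\<^sup>2"
    using z abs_Re_le_cmod [of "cinner (B f) f"] abs_Im_le_cmod [of "cinner (B f) f"] by linarith+
  have Mt: "4 * (M * t\<^sup>2) \<le> t"
    using mult_right_mono [OF t(2), of t] t by (simp add: power2_eq_square algebra_simps)
  define \<xi> where "\<xi> = \<sigma> * Re (cinner (B h) h)"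
  \<comment> \<open>Around the main term 2t the errors are t^2, 2 M t^2 and M t^2, together at most
    4 M t^2 <= t.\<close>
  have "\<xi> = \<sigma> * Re (cinner (B f) f) + 2 * t + t * Re (X - 1) + \<sigma> * (t\<^sup>2 * Re b)"
    using \<sigma> by (auto simp: \<xi>_def eh algebra_simps)
  then have \<xi>: "t \<le> \<xi>" "\<xi> \<le> 3 * t"
    using \<sigma> tX tb zb Mt t2 by (auto simp: abs_le_iff)
  have "Im (cinner (B h) h) = Im (cinner (B f) f) + \<sigma> * (t * Im (X - 1)) + t\<^sup>2 * Im b"
    by (simp add: eh algebra_simps)
  then have \<eta>: "Im (cinner (B h) h) \<le> 4 * (M * t\<^sup>2)"
    using \<sigma> tX tb zb t2 by (auto simp: abs_le_iff)
  have "\<xi> \<le> \<delta> * (norm h)\<^sup>2"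
    using \<xi> t mult_left_mono [OF h_lower, of \<delta>] by linarith
  then have "(8 * M + 1) * (Re (cinner (B h) h))\<^sup>2 \<le> Im (cinner (B h) h) * (norm h)\<^sup>2"
    using curv [OF h] \<xi> t by (simp add: \<xi>_def)
  also have "\<dots> \<le> 4 * (M * t\<^sup>2) * 2"
    using \<eta> h_upper M by (intro mult_mono) auto
  finally have "(8 * M + 1) * (Re (cinner (B h) h))\<^sup>2 \<le> 8 * M * t\<^sup>2" by simp
  moreover have "(Re (cinner (B h) h))\<^sup>2 = \<xi>\<^sup>2"
    using \<sigma> by (auto simp: \<xi>_def)
  moreover have "(8 * M + 1) * t\<^sup>2 \<le> (8 * M + 1) * \<xi>\<^sup>2"
    using \<xi> t M by (intro mult_left_mono power_mono) auto
  moreover have "0 < t\<^sup>2" using t by simp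
  ultimately show False by (simp add: algebra_simps)
qed

end

section \<open>The numerical range and its boundary\<close>

lemma cinner_linear_combination:
  assumes "linear_operator D A" "f \<in> D" "g \<in> D"
  shows "cinner (A (\<alpha> *\<^sub>C f + \<beta> *\<^sub>C g)) (\<alpha> *\<^sub>C f + \<beta> *\<^sub>C g) =
    \<alpha> * cnj \<alpha> * cinner (A f) f + \<beta> * cnj \<alpha> * cinner (A g) f +
    \<alpha> * cnj \<beta> * cinner (A f) g + \<beta> * cnj \<beta> * cinner (A g) (g::'a::complex_inner)"
proof -
  have "A (\<alpha> *\<^sub>C f + \<beta> *\<^sub>C g) = \<alpha> *\<^sub>C A f + \<beta> *\<^sub>C A g"
    using assms by (simp add: linear_operator_def complex_subspace_def)
  then show ?thesis
    by (simp add: cinner_add_left cinner_add_right cinner_scaleC_left cinner_scaleC_right algebra_simps)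
qed

text \<open>An affine change takes \<open>a\<close>, \<open>b\<close> to 0, 1; a suitable phase
  makes the form real along a path from \<open>f\<close> to a multiple of \<open>g\<close>, and the
  intermediate value theorem reaches \<open>u\<close>. Convexity provides the supporting line at the
  boundary point.\<close>

theorem Toeplitz_Hausdorff:
  fixes D :: "'a::complex_inner set"
  assumes lin: "linear_operator D A"
  shows "convex (num_range D A)"
  unfolding convex_alt
proof (intro ballI allI impI)
  fix a b :: complex and u :: real
  assume a: "a \<in> num_range D A" and b: "b \<in> num_range D A" and u: "0 \<le> u \<and> u \<le> 1"
  obtain f where f: "f \<in> D" "norm f = 1" "cinner (A f) f = a"
    using a by (auto simp: num_range_def)
  obtain g where g: "g \<in> D" "norm g = 1" "cinner (A g) g = b"
    using b by (auto simp: num_range_def)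
  show "(1 - u) *\<^sub>R a + u *\<^sub>R b \<in> num_range D A"
  proof (cases "a = b")
    case True
    then show ?thesis using a by (simp flip: scaleR_left_distrib)
  next
    case False
    define G where "G = cinner g f"
    have G': "cinner f g = cnj G" using cinner_commute [of f g] by (simp add: G_def)
    \<comment> \<open>\<open>P\<close> and \<open>Q\<close> are the cross terms of (A - a) / (b -
      a), whose values at \<open>f\<close> and \<open>g\<close> are 0 and 1.\<close>
    define P where "P = (cinner (A g) f - a * G) / (b - a)"
    define Q where "Q = (cinner (A f) g - a * cnj G) / (b - a)"
    define W where "W = P - cnj Q"
    \<comment> \<open>Im (cP + cnj c Q) equals Im (cW), so the phase of \<open>W\<close> has to be
      cancelled; the default 1 keeps |c| = 1.\<close>
    define c where "c = (if W = 0 then 1 else cnj W / of_real (norm W))"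
    have nc: "norm c = 1" by (simp add: c_def norm_divide)
    then have cc: "c * cnj c = 1"
      by (simp add: complex_norm_square [symmetric])
    define r where "r = Re (c * P + cnj c * Q)"
    \<comment> \<open>the phase \<open>c\<close> makes the compressed form real along the path \<open>(1 - s) f + s c g\<close>\<close>
    have r: "c * P + cnj c * Q = of_real r"
    proof -
      have "c * W = of_real (norm W)"
        by (simp add: c_def complex_norm_square [symmetric] power2_eq_square mult.commute)
      then have "Im (c * W) = 0" by simp
      then have "Im (c * P + cnj c * Q) = 0" by (simp add: W_def algebra_simps)
      then show ?thesis by (simp add: r_def complex_eq_iff)
    qed
    define h where "h s = of_real (1 - s) *\<^sub>C f + (of_real s * c) *\<^sub>C g" for s :: real
    have hD: "h s \<in> D" for s
      using lin f(1) g(1) by (auto simp: h_def linear_operator_def complex_subspace_def)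
    \<comment> \<open>The squared norm of \<open>h s\<close> is the form of the identity, so the
      same expansion computes it.\<close>
    have id: "linear_operator D (\<lambda>x. x)"
      using lin by (simp add: linear_operator_def)
    define N where "N s = (norm (h s))\<^sup>2" for s
    have N: "of_real (N s) = of_real ((1 - s)\<^sup>2 + s\<^sup>2) + of_real (s * (1 - s)) * (c * G + cnj c * cnj G)" for s
    proof -
      have "of_real (N s) = cinner (h s) (h s)" by (simp add: N_def cinner_self)
      also have "\<dots> = of_real ((1 - s)\<^sup>2) + of_real (s * (1 - s)) * (c * G + cnj c * cnj G) + of_real (s\<^sup>2) * (c * cnj c)"
        unfolding h_def cinner_linear_combination [OF id f(1) g(1)] G'
        using f(2) g(2) by (simp add: cinner_self G_def [symmetric] power2_eq_square algebra_simps)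
      finally show ?thesis by (simp add: cc)
    qed
    have key: "cinner (A (h s)) (h s) = a * of_real (N s) + (b - a) * of_real (s\<^sup>2 + s * (1 - s) * r)" for s
    proof -
      have P': "cinner (A g) f = (b - a) * P + a * G" and Q': "cinner (A f) g = (b - a) * Q + a * cnj G"
        using False by (simp_all add: P_def Q_def)
      have "cinner (A (h s)) (h s) = of_real ((1 - s)\<^sup>2) * a
          + of_real (s * (1 - s)) * (c * cinner (A g) f + cnj c * cinner (A f) g) + of_real (s\<^sup>2) * (c * cnj c) * b"
        unfolding h_def cinner_linear_combination [OF lin f(1) g(1)] f(3) g(3)
        by (simp add: power2_eq_square algebra_simps)
      also have "\<dots> = a * of_real (N s) + (b - a) * (of_real (s\<^sup>2) + of_real (s * (1 - s)) * (c * P + cnj c * Q))"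
        unfolding N P' Q' cc by (simp add: algebra_simps)
      finally show ?thesis by (simp add: r)
    qed
    \<comment> \<open>A zero on the path would make \<open>f\<close> a unimodular multiple of
      \<open>g\<close>, and then \<open>a = b\<close>.\<close>
    have N_pos: "0 < N s" for s
    proof (rule ccontr)
      assume "\<not> 0 < N s"
      then have "h s = 0" by (simp add: N_def)
      then have *: "of_real (1 - s) *\<^sub>C f = - ((of_real s * c) *\<^sub>C g)"
        by (simp add: h_def eq_neg_iff_add_eq_0)
      then have "norm (of_real (1 - s) *\<^sub>C f) = norm ((of_real s * c) *\<^sub>C g)" by simp
      then have "\<bar>1 - s\<bar> = \<bar>s\<bar>" using f(2) g(2) nc by (simp only: norm_scaleC norm_mult norm_of_real mult_1_right)
      then have "s = 1 / 2" by linarith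
      with * have "2 *\<^sub>C (of_real (1 / 2) *\<^sub>C f) = 2 *\<^sub>C (- ((of_real (1 / 2) * c) *\<^sub>C g))"
        by simp
      then have f_eq: "f = (- c) *\<^sub>C g"
        by (simp add: scaleC_scaleC scaleC_one scaleC_minus_right scaleC_minus_left)
      then have "A f = (- c) *\<^sub>C A g"
        using lin g(1) unfolding linear_operator_def by blast
      then have "cinner (A f) f = cinner ((- c) *\<^sub>C A g) ((- c) *\<^sub>C g)"
        by (rule arg_cong2 [OF _ f_eq])
      then have "cinner (A f) f = c * cnj c * cinner (A g) g"
        by (simp add: cinner_scaleC_left cinner_scaleC_right)
      then show False using f(3) g(3) cc False by simp
    qed
    define \<phi> where "\<phi> s = (s\<^sup>2 + s * (1 - s) * r) / N s" for s
    have "N s = (1 - s)\<^sup>2 + s\<^sup>2 + s * (1 - s) * Re (c * G + cnj c * cnj G)" for s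
      using arg_cong [OF N [of s], of Re] by simp
    then have N_fun: "N = (\<lambda>s. (1 - s)\<^sup>2 + s\<^sup>2 + s * (1 - s) * Re (c * G + cnj c * cnj G))" by blast
    have "continuous_on {0..1} N"
      unfolding N_fun by (intro continuous_intros)
    then have "continuous_on {0..1} \<phi>"
      unfolding \<phi>_def using N_pos by (intro continuous_intros) (auto simp: less_imp_neq [symmetric])
    moreover have "\<phi> 0 = 0" "\<phi> 1 = 1" by (simp_all add: \<phi>_def N_fun)
    ultimately obtain s where s: "\<phi> s = u"
      using IVT' [of \<phi> 0 u 1] u by auto
    define k where "k = of_real (1 / sqrt (N s)) *\<^sub>C h s"
    have k: "k \<in> D" "norm k = 1"
      using hD [of s] lin N_pos [of s]
      by (auto simp: k_def linear_operator_def complex_subspace_def norm_scaleC norm_divide N_def)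
    have "cinner (A k) k = of_real (1 / N s) * cinner (A (h s)) (h s)"
    proof -
      have "cinner (A k) k = of_real (1 / sqrt (N s)) * of_real (1 / sqrt (N s)) * cinner (A (h s)) (h s)"
        using hD [of s] lin by (simp add: k_def linear_operator_def cinner_scaleC_left cinner_scaleC_right)
      also have "of_real (1 / sqrt (N s)) * of_real (1 / sqrt (N s)) = (of_real (1 / N s) :: complex)"
        using N_pos [of s] by (simp flip: of_real_mult)
      finally show ?thesis .
    qed
    also have "\<dots> = a + (b - a) * of_real (\<phi> s)"
      unfolding key \<phi>_def using N_pos [of s] by (simp add: field_simps)
    also have "\<dots> = (1 - u) *\<^sub>R a + u *\<^sub>R b"
      unfolding s by (simp add: scaleR_conv_of_real algebra_simps)
    finally show ?thesis using k by (auto simp: num_range_def intro!: exI [of _ k])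
  qed
qed

section \<open>Infinite curvature as a family of inequalities\<close>

text \<open>\<open>Lim\<close> is a definite description and says nothing before convergence is
  known; monotonicity provides it, with the supremum as limit.\<close>

lemma Lim_at_right_antitone_PInfty:
  fixes \<phi> :: "real \<Rightarrow> ereal"
  assumes antitone: "\<And>x y. 0 < x \<Longrightarrow> x \<le> y \<Longrightarrow> \<phi> y \<le> \<phi> x"
    and "Lim (at_right 0) \<phi> = \<infinity>"
  obtains \<epsilon> where "0 < \<epsilon>" "ereal K < \<phi> \<epsilon>"
proof -
  have "(\<phi> \<longlongrightarrow> (SUP \<epsilon>\<in>{0<..}. \<phi> \<epsilon>)) (at_right 0)"
  proof (rule increasing_tendsto)
    show "\<forall>\<^sub>F \<epsilon> in at_right 0. \<phi> \<epsilon> \<le> (SUP \<epsilon>\<in>{0<..}. \<phi> \<epsilon>)"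
      using eventually_at_right_less [of 0] by eventually_elim (auto intro: SUP_upper)
    fix x assume "x < (SUP \<epsilon>\<in>{0<..}. \<phi> \<epsilon>)"
    then obtain \<epsilon> where "0 < \<epsilon>" "x < \<phi> \<epsilon>" by (auto simp: less_SUP_iff)
    then have "\<And>y. 0 < y \<Longrightarrow> y < \<epsilon> \<Longrightarrow> x < \<phi> y"
      using antitone by (meson less_imp_le less_le_trans)
    then show "\<forall>\<^sub>F \<epsilon> in at_right 0. x < \<phi> \<epsilon>"
      using \<open>0 < \<epsilon>\<close> by (auto simp: eventually_at_right_field)
  qed
  then have "(SUP \<epsilon>\<in>{0<..}. \<phi> \<epsilon>) = \<infinity>"
    using assms(2) tendsto_Lim [OF trivial_limit_at_right_real] by metis
  then have "ereal K < (SUP \<epsilon>\<in>{0<..}. \<phi> \<epsilon>)" by simp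
  then show ?thesis using that by (auto simp: less_SUP_iff)
qed

lemma unilateral_infinite_curvature_frontier:
  assumes "unilateral_infinite_curvature \<Omega> a"
  defines "e \<equiv> frame_dir \<Omega> a (l_line \<Omega> a)"
  obtains \<sigma> :: real where "\<sigma> = 1 \<or> \<sigma> = - 1"
    "\<And>K. \<exists>\<epsilon>>0. \<forall>z\<in>frontier \<Omega>. (Re ((z - a) * cnj e))\<^sup>2 + (Im ((z - a) * cnj e))\<^sup>2 \<le> \<epsilon>\<^sup>2 \<longrightarrow>
      0 < \<sigma> * Re ((z - a) * cnj e) \<longrightarrow> K * (Re ((z - a) * cnj e))\<^sup>2 \<le> Im ((z - a) * cnj e)"
proof -
  define S where "S \<sigma> \<epsilon> = {z \<in> frontier \<Omega>. (Re ((z - a) * cnj e))\<^sup>2 + (Im ((z - a) * cnj e))\<^sup>2 \<le> \<epsilon>\<^sup>2 \<and>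
    0 < \<sigma> * Re ((z - a) * cnj e)}" for \<sigma> \<epsilon> :: real
  define q where "q z = ereal (Im ((z - a) * cnj e) / (Re ((z - a) * cnj e))\<^sup>2)" for z
  have "gamma_l_plus \<Omega> a = Lim (at_right 0) (\<lambda>\<epsilon>. Inf (q ` S 1 \<epsilon>))"
    unfolding gamma_l_plus_def Let_def xi_coord_def eta_coord_def e_def [symmetric] S_def q_def
    by (intro arg_cong [where f = "Lim _"] ext arg_cong [where f = Inf]) auto
  moreover have "gamma_l_minus \<Omega> a = Lim (at_right 0) (\<lambda>\<epsilon>. Inf (q ` S (- 1) \<epsilon>))"
    unfolding gamma_l_minus_def Let_def xi_coord_def eta_coord_def e_def [symmetric] S_def q_def
    by (intro arg_cong [where f = "Lim _"] ext arg_cong [where f = Inf]) auto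
  ultimately obtain \<sigma> :: real where \<sigma>: "\<sigma> = 1 \<or> \<sigma> = - 1" and lim: "Lim (at_right 0) (\<lambda>\<epsilon>. Inf (q ` S \<sigma> \<epsilon>)) = \<infinity>"
    using assms(1) unfolding unilateral_infinite_curvature_def by metis
  have "\<exists>\<epsilon>>0. \<forall>z\<in>S \<sigma> \<epsilon>. K * (Re ((z - a) * cnj e))\<^sup>2 \<le> Im ((z - a) * cnj e)" for K
  proof -
    have "Inf (q ` S \<sigma> y) \<le> Inf (q ` S \<sigma> x)" if "0 < x" "x \<le> y" for x y
    proof -
      have "x\<^sup>2 \<le> y\<^sup>2" using that by (intro power_mono) auto
      then show ?thesis by (intro Inf_superset_mono image_mono) (auto simp: S_def)
    qed
    then obtain \<epsilon> where \<epsilon>: "0 < \<epsilon>" "ereal K < Inf (q ` S \<sigma> \<epsilon>)"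
      using Lim_at_right_antitone_PInfty [OF _ lim] by metis
    have "K * (Re ((z - a) * cnj e))\<^sup>2 \<le> Im ((z - a) * cnj e)" if z: "z \<in> S \<sigma> \<epsilon>" for z
    proof -
      have "ereal K < q z" using \<epsilon>(2) z by (meson INF_lower less_le_trans)
      moreover have "0 < (Re ((z - a) * cnj e))\<^sup>2" using z by (auto simp: S_def)
      ultimately show ?thesis by (simp add: q_def pos_less_divide_eq less_imp_le)
    qed
    then show ?thesis using \<epsilon>(1) by blast
  qed
  then have "\<exists>\<epsilon>>0. \<forall>z\<in>frontier \<Omega>. (Re ((z - a) * cnj e))\<^sup>2 + (Im ((z - a) * cnj e))\<^sup>2 \<le> \<epsilon>\<^sup>2 \<longrightarrow>
      0 < \<sigma> * Re ((z - a) * cnj e) \<longrightarrow> K * (Re ((z - a) * cnj e))\<^sup>2 \<le> Im ((z - a) * cnj e)" for K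
    unfolding S_def by blast
  then show ?thesis by (rule that [OF \<sigma>])
qed

text \<open>Curvature concerns frontier points, but values of the form may lie inside. Beneath a
  violating point is a frontier point with the same abscissa and no larger ordinate, which violates
  the bound too. The ordinate needs no smallness assumption, since a violation bounds it.\<close>

lemma curvature_bound_interior:
  fixes \<Omega> :: "complex set" and \<sigma> :: real
  assumes "closed \<Omega>" and e: "norm e = 1" and \<sigma>: "\<sigma> = 1 \<or> \<sigma> = - 1"
    and half: "\<And>z. z \<in> \<Omega> \<Longrightarrow> 0 \<le> Im ((z - a) * cnj e)"
    and bd: "\<And>K. \<exists>\<epsilon>>0. \<forall>z\<in>frontier \<Omega>. (Re ((z - a) * cnj e))\<^sup>2 + (Im ((z - a) * cnj e))\<^sup>2 \<le> \<epsilon>\<^sup>2 \<longrightarrow>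
      0 < \<sigma> * Re ((z - a) * cnj e) \<longrightarrow> K * (Re ((z - a) * cnj e))\<^sup>2 \<le> Im ((z - a) * cnj e)"
  shows "\<exists>\<delta>>0. \<forall>z\<in>\<Omega>. 0 < \<sigma> * Re ((z - a) * cnj e) \<longrightarrow> \<sigma> * Re ((z - a) * cnj e) \<le> \<delta> \<longrightarrow>
      K * (Re ((z - a) * cnj e))\<^sup>2 \<le> Im ((z - a) * cnj e)"
proof -
  obtain \<epsilon> where \<epsilon>: "0 < \<epsilon>" and bd': "\<And>z. z \<in> frontier \<Omega> \<Longrightarrow>
      (Re ((z - a) * cnj e))\<^sup>2 + (Im ((z - a) * cnj e))\<^sup>2 \<le> \<epsilon>\<^sup>2 \<Longrightarrow>
      0 < \<sigma> * Re ((z - a) * cnj e) \<Longrightarrow> K * (Re ((z - a) * cnj e))\<^sup>2 \<le> Im ((z - a) * cnj e)"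
    using bd [of K] by blast
  \<comment> \<open>A violation gives \<open>\<eta>' \<le> \<bar>K\<bar> * \<delta>\<close>, using
    \<delta> <= 1; hence the frontier point is within \<delta> (1 + |K|) <= \<epsilon> of
    \<open>a\<close>.\<close>
  define \<delta> where "\<delta> = min 1 (\<epsilon> / (1 + \<bar>K\<bar>))"
  have \<delta>: "0 < \<delta>" "\<delta> \<le> 1" "\<delta> * (1 + \<bar>K\<bar>) \<le> \<epsilon>"
    using \<epsilon> by (auto simp: \<delta>_def simp flip: pos_le_divide_eq)
  have ee: "e * cnj e = 1" using e by (simp add: complex_norm_square [symmetric])
  have "K * (Re ((z - a) * cnj e))\<^sup>2 \<le> Im ((z - a) * cnj e)"
    if z: "z \<in> \<Omega>" "0 < \<sigma> * Re ((z - a) * cnj e)" "\<sigma> * Re ((z - a) * cnj e) \<le> \<delta>" for z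
  proof (rule ccontr)
    \<comment> \<open>descend from \<open>z\<close> to the boundary along the normal direction\<close>
    assume neg: "\<not> ?thesis"
    define \<xi> \<eta> where "\<xi> = Re ((z - a) * cnj e)" and "\<eta> = Im ((z - a) * cnj e)"
    \<comment> \<open>The normal coordinate of \<open>z'\<close> is -1, outside the half
      plane.\<close>
    define z' where "z' = z - (\<i> * of_real (\<eta> + 1)) * e"
    have coord: "((1 - u) *\<^sub>R z + u *\<^sub>R z' - a) * cnj e = Complex \<xi> (\<eta> - u * (\<eta> + 1))" for u
    proof -
      have "((1 - u) *\<^sub>R z + u *\<^sub>R z' - a) * cnj e = (z - a) * cnj e - \<i> * of_real (u * (\<eta> + 1)) * (e * cnj e)"
        by (simp add: z'_def scaleR_conv_of_real algebra_simps)
      then show ?thesis by (simp add: ee \<xi>_def \<eta>_def complex_eq_iff)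
    qed
    have "z' \<notin> \<Omega>" using coord [of 1] half [of z'] by auto
    then obtain w where w: "w \<in> closed_segment z z'" "w \<in> frontier \<Omega>"
      using connected_Int_frontier [of "closed_segment z z'" \<Omega>] z(1) by auto
    then obtain u where u: "0 \<le> u" "w = (1 - u) *\<^sub>R z + u *\<^sub>R z'"
      by (auto simp: closed_segment_def)
    define \<eta>' where "\<eta>' = Im ((w - a) * cnj e)"
    have w': "(w - a) * cnj e = Complex \<xi> \<eta>'" "\<eta>' = \<eta> - u * (\<eta> + 1)"
      using coord [of u] by (simp_all add: u(2) \<eta>'_def)
    have "0 \<le> \<eta>'" using half w(2) \<open>closed \<Omega>\<close> by (auto simp: \<eta>'_def frontier_def)
    have "0 \<le> \<eta>" using half [OF z(1)] by (simp add: \<eta>_def)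
    then have "\<eta>' \<le> \<eta>" using u(1) by (simp add: w'(2))
    have "\<eta> < K * \<xi>\<^sup>2" using neg by (simp add: \<xi>_def \<eta>_def)
    have \<xi>: "\<bar>\<xi>\<bar> \<le> \<delta>" "0 < \<sigma> * \<xi>" using z \<sigma> by (auto simp: \<xi>_def)
    have "\<xi>\<^sup>2 \<le> \<delta>\<^sup>2" using \<xi>(1) by (rule abs_le_square_iff [THEN iffD1, OF order_trans]) simp
    have "\<eta>' \<le> \<bar>K\<bar> * \<delta>"
    proof -
      have "K * \<xi>\<^sup>2 \<le> \<bar>K\<bar> * \<delta>\<^sup>2" using \<open>\<xi>\<^sup>2 \<le> \<delta>\<^sup>2\<close> by (intro mult_mono) auto
      also have "\<dots> \<le> \<bar>K\<bar> * \<delta>" using \<delta> by (intro mult_left_mono) (auto simp: power2_eq_square mult_left_le_one_le)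
      finally show ?thesis using \<open>\<eta>' \<le> \<eta>\<close> \<open>\<eta> < K * \<xi>\<^sup>2\<close> by linarith
    qed
    then have "\<eta>'\<^sup>2 \<le> (\<bar>K\<bar> * \<delta>)\<^sup>2" using \<open>0 \<le> \<eta>'\<close> by (intro power_mono)
    with \<open>\<xi>\<^sup>2 \<le> \<delta>\<^sup>2\<close> have "\<xi>\<^sup>2 + \<eta>'\<^sup>2 \<le> \<delta>\<^sup>2 + (\<bar>K\<bar> * \<delta>)\<^sup>2" by simp
    also have "\<dots> \<le> (\<delta> * (1 + \<bar>K\<bar>))\<^sup>2"
      using \<delta> by (simp add: power2_eq_square algebra_simps)
    also have "\<dots> \<le> \<epsilon>\<^sup>2" using \<delta> by (intro power_mono) auto
    finally have "K * \<xi>\<^sup>2 \<le> \<eta>'"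
      using bd' [OF w(2)] \<xi>(2) by (simp add: w'(1))
    then show False using \<open>\<eta>' \<le> \<eta>\<close> \<open>\<eta> < K * \<xi>\<^sup>2\<close> by linarith
  qed
  then show ?thesis using \<delta>(1) by blast
qed

section \<open>Supporting lines at a non-corner point\<close>

text \<open>\<open>e\<close> is the tangent direction with i e = v / |v| for the inner normal
  \<open>v\<close>. The nonempty interior lets the supporting hyperplane theorem for relative
  frontiers apply.\<close>

lemma convex_supporting_direction:
  fixes W :: "complex set"
  assumes "convex W" "interior W \<noteq> {}" "a \<in> frontier W"
  obtains e where "norm e = 1" "\<And>z. z \<in> closure W \<Longrightarrow> 0 \<le> Im ((z - a) * cnj e)"
proof -
  have a: "a \<in> closure W" "a \<notin> rel_interior W"
    using assms(2,3) rel_interior_nonempty_interior [OF assms(2)] by (simp_all add: frontier_def)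
  obtain v where v: "v \<noteq> 0" "\<And>y. y \<in> closure W \<Longrightarrow> inner v a \<le> inner v y"
    using supporting_hyperplane_relative_frontier [OF assms(1) a] by metis
  define e where "e = - \<i> * sgn v"
  have "Im ((z - a) * cnj e) = (inner v z - inner v a) / norm v" for z
    by (simp add: e_def sgn_div_norm inner_complex_def scaleR_conv_of_real divide_simps algebra_simps)
  then have "0 \<le> Im ((z - a) * cnj e)" if "z \<in> closure W" for z
    using v(2) [OF that] by (metis diff_ge_0_iff_ge divide_nonneg_nonneg norm_ge_zero)
  moreover have "norm e = 1" using v(1) by (simp add: e_def norm_mult norm_sgn)
  ultimately show ?thesis using that by blast
qed

lemma inverse_unit: "norm e = 1 \<Longrightarrow> z / e = z * cnj (e::complex)"
  by (subst complex_div_cnj) simp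

text \<open>\<open>l_line\<close> and \<open>frame_dir\<close> are choice terms: absence of a corner
  makes the \<open>THE\<close> determinate, and \<open>e0\<close> is a witness for the
  \<open>SOME\<close>.\<close>

lemma frame_dir_non_corner:
  assumes e0: "norm e0 = 1" "\<And>z. z \<in> \<Omega> \<Longrightarrow> 0 \<le> Im ((z - a) * cnj e0)"
    and "\<not> corner_point \<Omega> a"
  defines "e \<equiv> frame_dir \<Omega> a (l_line \<Omega> a)"
  shows "norm e = 1" and "\<And>z. z \<in> \<Omega> \<Longrightarrow> 0 \<le> Im ((z - a) * cnj e)"
    and "\<And>L. supporting_line \<Omega> a L \<Longrightarrow> L = line_through a e"
proof -
  have L: "supporting_line \<Omega> a (line_through a e0)"
    unfolding supporting_line_def using e0 by (intro exI [of _ e0]) (auto simp: inverse_unit)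
  have unique: "L = line_through a e0" if "supporting_line \<Omega> a L" for L
    using that L assms(3) by (auto simp: corner_point_def)
  then have l: "l_line \<Omega> a = line_through a e0"
    unfolding l_line_def by (intro the_equality L)
  have "norm e = 1 \<and> line_through a e0 = line_through a e \<and> (\<forall>z\<in>\<Omega>. 0 \<le> Im ((z - a) * cnj e))"
    unfolding e_def frame_dir_def l by (rule someI [of _ e0]) (use e0 in auto)
  then show "norm e = 1" "\<And>z. z \<in> \<Omega> \<Longrightarrow> 0 \<le> Im ((z - a) * cnj e)"
    "\<And>L. supporting_line \<Omega> a L \<Longrightarrow> L = line_through a e"
    using unique by auto
qed

text \<open>Otherwise \<open>W\<close> would also lie above the line through \<open>a\<close> of
  slope \<open>\<sigma> * \<tau>\<close>, which on the other side of \<open>a\<close> runs below the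
  axis: a second supporting line.\<close>

lemma tangential_points:
  fixes \<sigma> \<tau> :: real
  assumes e: "norm e = 1" and half: "\<And>z. z \<in> closure W \<Longrightarrow> 0 \<le> Im ((z - a) * cnj e)"
    and unique: "\<And>L. supporting_line (closure W) a L \<Longrightarrow> L = line_through a e"
    and \<sigma>: "\<sigma> = 1 \<or> \<sigma> = - 1" and \<tau>: "0 < \<tau>"
  obtains z where "z \<in> W" "0 < \<sigma> * Re ((z - a) * cnj e)"
    "Im ((z - a) * cnj e) < \<tau> * (\<sigma> * Re ((z - a) * cnj e))"
proof (rule ccontr)
  assume "\<not> thesis"
  then have witness: "z \<in> W \<Longrightarrow> 0 < \<sigma> * Re ((z - a) * cnj e) \<Longrightarrow>
      Im ((z - a) * cnj e) < \<tau> * (\<sigma> * Re ((z - a) * cnj e)) \<Longrightarrow> False" for z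
    using that by blast
  have no: "\<not> (0 < \<sigma> * Re ((z - a) * cnj e) \<and> Im ((z - a) * cnj e) < \<tau> * (\<sigma> * Re ((z - a) * cnj e)))"
    if "z \<in> W" for z using witness [OF that] by blast
  define u where "u = e * Complex 1 (\<sigma> * \<tau>)"
  have "W \<subseteq> {z. \<tau> * (\<sigma> * Re ((z - a) * cnj e)) \<le> Im ((z - a) * cnj e)}"
  proof
    fix z assume z: "z \<in> W"
    show "z \<in> {z. \<tau> * (\<sigma> * Re ((z - a) * cnj e)) \<le> Im ((z - a) * cnj e)}"
    proof (cases "0 < \<sigma> * Re ((z - a) * cnj e)")
      case True
      then show ?thesis using no [OF z] by auto
    next
      case False
      have "\<tau> * (\<sigma> * Re ((z - a) * cnj e)) \<le> 0"
        by (rule mult_nonneg_nonpos) (use \<tau> False in linarith)+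
      also have "\<dots> \<le> Im ((z - a) * cnj e)"
        using half closure_subset z by blast
      finally show ?thesis by simp
    qed
  qed
  moreover have "closed {z. \<tau> * (\<sigma> * Re ((z - a) * cnj e)) \<le> Im ((z - a) * cnj e)}"
    by (intro closed_Collect_le continuous_intros)
  ultimately have above: "\<tau> * (\<sigma> * Re ((z - a) * cnj e)) \<le> Im ((z - a) * cnj e)" if "z \<in> closure W" for z
    using closure_minimal that by blast
  have "0 \<le> Im ((z - a) / u)" if "z \<in> closure W" for z
  proof -
    have "(z - a) / u = ((z - a) * cnj e) / Complex 1 (\<sigma> * \<tau>)"
      unfolding u_def inverse_unit [OF e, symmetric] by (simp only: divide_divide_eq_left)
    then have "Im ((z - a) / u) = (Im ((z - a) * cnj e) - \<tau> * (\<sigma> * Re ((z - a) * cnj e))) / (1 + (\<sigma> * \<tau>)\<^sup>2)"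
      by (simp only: Im_divide complex.sel) (simp add: algebra_simps)
    then show ?thesis using above [OF that] by simp
  qed
  moreover have "u \<noteq> 0" using e by (auto simp: u_def Complex_eq_0)
  ultimately have "supporting_line (closure W) a (line_through a u)"
    unfolding supporting_line_def by (intro exI [of _ u]) simp
  from unique [OF this] have "line_through a u = line_through a e" .
  moreover have "a + of_real 1 * u \<in> line_through a u"
    unfolding line_through_def by blast
  ultimately obtain t where "u = of_real t * e" by (auto simp: line_through_def)
  then have "e * Complex 1 (\<sigma> * \<tau>) = e * of_real t" by (simp add: u_def mult.commute)
  then have "Complex 1 (\<sigma> * \<tau>) = of_real t" using e by auto
  then show False using \<sigma> \<tau> by (auto simp: complex_eq_iff)
qed

section \<open>Points of unilateral infinite curvature\<close>

theorem mainTheorem5: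
  fixes D :: "'h::chilbert_space set" and A :: "'h \<Rightarrow> 'h" and \<mu> :: complex
  assumes "densely_defined D"
    and "closed_operator D A"
    and "interior (num_range D A) \<noteq> {}"
    and "num_range D A \<noteq> UNIV"
    and "D \<subseteq> adjoint_domain D A"
    and "spectrum_op D A \<subseteq> closure (num_range D A)"
    and "\<mu> \<in> frontier (num_range D A)"
    and "unilateral_infinite_curvature (closure (num_range D A)) \<mu>"
    and "\<not> corner_point (closure (num_range D A)) \<mu>"
  shows "\<not> closed ((\<lambda>f. A f - \<mu> *\<^sub>C f) ` D) \<and> \<mu> \<in> ess_spectrum D A"
proof -
  define W where "W = num_range D A"
  have lin: "linear_operator D A" and graph_A: "closed (graph D A)"
    using assms(2) by (auto simp: closed_operator_def)
  obtain e0 where e0: "norm e0 = 1" "\<And>z. z \<in> closure W \<Longrightarrow> 0 \<le> Im ((z - \<mu>) * cnj e0)"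
    using convex_supporting_direction [OF Toeplitz_Hausdorff [OF lin] assms(3,7)] unfolding W_def by blast
  define e where "e = frame_dir (closure W) \<mu> (l_line (closure W) \<mu>)"
  note frame = frame_dir_non_corner [OF e0 assms(9) [folded W_def], folded e_def]
  have ee: "e * cnj e = 1" using frame(1) by (simp add: complex_norm_square [symmetric])
  obtain \<sigma> :: real where \<sigma>: "\<sigma> = 1 \<or> \<sigma> = - 1" and frontier_bd:
    "\<And>K. \<exists>\<epsilon>>0. \<forall>z\<in>frontier (closure W). (Re ((z - \<mu>) * cnj e))\<^sup>2 + (Im ((z - \<mu>) * cnj e))\<^sup>2 \<le> \<epsilon>\<^sup>2 \<longrightarrow>
      0 < \<sigma> * Re ((z - \<mu>) * cnj e) \<longrightarrow> K * (Re ((z - \<mu>) * cnj e))\<^sup>2 \<le> Im ((z - \<mu>) * cnj e)"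
    using unilateral_infinite_curvature_frontier [OF assms(8) [folded W_def], folded e_def] by blast
  note bd = curvature_bound_interior [OF closed_closure frame(1) \<sigma> frame(2) frontier_bd]
  define B where "B f = cnj e *\<^sub>C (A f - \<mu> *\<^sub>C f)" for f
  have form: "cinner (B f) f = (cinner (A f) f - \<mu> * of_real ((norm f)\<^sup>2)) * cnj e" for f
    by (simp add: B_def cinner_scaleC_left cinner_diff_left cinner_self mult.commute)
  have unit_form: "\<exists>z\<in>W. cinner (B f) f = of_real ((norm f)\<^sup>2) * ((z - \<mu>) * cnj e)"
    if f: "f \<in> D" "f \<noteq> 0" for f
  proof -
    define k where "k = of_real (1 / norm f) *\<^sub>C f"
    have k: "k \<in> D" "A k = of_real (1 / norm f) *\<^sub>C A f" "norm k = 1"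
      using f lin by (auto simp: k_def linear_operator_def complex_subspace_def norm_scaleC norm_divide)
    have "of_real ((norm f)\<^sup>2) * cinner (A k) k = cinner (A f) f"
      unfolding k(2) using f(2)
      by (simp add: k_def cinner_scaleC_left cinner_scaleC_right power2_eq_square)
    then have "cinner (B f) f = of_real ((norm f)\<^sup>2) * ((cinner (A k) k - \<mu>) * cnj e)"
      unfolding form by (simp add: algebra_simps)
    moreover have "cinner (A k) k \<in> W" using k(1,3) by (auto simp: W_def num_range_def)
    ultimately show ?thesis by blast
  qed
  have B_unit: "cinner (B f) f = (cinner (A f) f - \<mu>) * cnj e" if "norm f = 1" for f
    using that by (simp add: form)
  have "\<not> closed ((\<lambda>f. A f - \<mu> *\<^sub>C f) ` D)"
  proof
    assume closed_range_A: "closed ((\<lambda>f. A f - \<mu> *\<^sub>C f) ` D)"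
    have eB: "e *\<^sub>C B f = A f - \<mu> *\<^sub>C f" for f
      by (simp add: B_def scaleC_scaleC ee scaleC_one)
    have cont: "continuous_on S (\<lambda>x. c *\<^sub>C x)" for S :: "'h set" and c
      by (rule bounded_linear.continuous_on [OF bounded_linear_scaleC continuous_on_id])
    have cancel: "x = y" if "e *\<^sub>C x = e *\<^sub>C y" for x y :: 'h
      using arg_cong [OF that, of "\<lambda>x. cnj e *\<^sub>C x"] ee
      by (simp add: scaleC_scaleC scaleC_one mult.commute)
    interpret upper_half_plane_operator D B
    proof
      show "linear_operator D B"
        using lin by (simp add: linear_operator_def B_def scaleC_add_right scaleC_diff_right scaleC_scaleC mult.commute mult.left_commute)
      have B_eq: "e *\<^sub>C y + \<mu> *\<^sub>C x = A x \<longleftrightarrow> y = B x" for x y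
        using eB [of x] cancel [of y "B x"] by (metis add_diff_cancel_right' diff_add_cancel)
      have "graph D B = (\<lambda>(x, y). (x, e *\<^sub>C y + \<mu> *\<^sub>C x)) -` graph D A"
        by (auto simp: graph_def B_eq)
      also have "closed \<dots>"
        unfolding case_prod_unfold
        by (intro closed_vimage graph_A continuous_intros bounded_linear.continuous_on [OF bounded_linear_scaleC])
      finally show "closed (graph D B)" .
      fix f assume f: "f \<in> D"
      show "0 \<le> Im (cinner (B f) f)"
      proof (cases "f = 0")
        case False
        then obtain z where "z \<in> W" "cinner (B f) f = of_real ((norm f)\<^sup>2) * ((z - \<mu>) * cnj e)"
          using unit_form f by blast
        moreover have "0 \<le> Im ((z - \<mu>) * cnj e)"
          using frame(2) closure_subset calculation(1) by blast
        then have "0 \<le> (norm f)\<^sup>2 * Im ((z - \<mu>) * cnj e)" by simp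
        ultimately show ?thesis
          by (simp only: scaleR_conv_of_real [symmetric] scaleR_complex.sel)
      qed simp
    next
      fix \<epsilon> :: real and y :: 'h assume \<epsilon>: "0 < \<epsilon>"
      \<comment> \<open>\<open>\<nu>\<close> is at distance eps below the supporting line, hence off
        the spectrum, and A - \<open>\<nu>\<close> is \<open>e\<close> times the shifted
        \<open>B\<close>.\<close>
      define \<nu> where "\<nu> = \<mu> - \<i> * of_real \<epsilon> * e"
      have "(\<nu> - \<mu>) * cnj e = - (\<i> * of_real \<epsilon>) * (e * cnj e)" by (simp add: \<nu>_def)
      then have "Im ((\<nu> - \<mu>) * cnj e) < 0" using \<epsilon> by (simp add: ee)
      then have "\<nu> \<notin> closure W" using frame(2) [of \<nu>] by linarith
      then have "bij_betw (\<lambda>f. A f - \<nu> *\<^sub>C f) D UNIV"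
        using assms(6) by (auto simp: W_def spectrum_op_def)
      then obtain x where x: "x \<in> D" "A x - \<nu> *\<^sub>C x = e *\<^sub>C y"
        unfolding bij_betw_def by (metis (no_types, lifting) UNIV_I imageE)
      have "e *\<^sub>C (B x + (\<i> * of_real \<epsilon>) *\<^sub>C x) = e *\<^sub>C y"
        using x(2) by (simp add: scaleC_add_right eB scaleC_scaleC \<nu>_def scaleC_diff_left
            diff_diff_eq2 diff_add_eq mult.commute mult.left_commute)
      then show "\<exists>x\<in>D. B x + (\<i> * of_real \<epsilon>) *\<^sub>C x = y"
        using x(1) cancel by blast
    next
      have "B ` D = (\<lambda>x. e *\<^sub>C x) -` ((\<lambda>f. A f - \<mu> *\<^sub>C f) ` D)"
        by (auto simp: eB [symmetric] dest: cancel)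
      then show "closed (B ` D)"
        using closed_vimage [OF closed_range_A cont] by simp
    qed
    show False
    proof (rule infinite_curvature_contradiction [OF \<sigma>])
      fix K
      obtain \<delta> where \<delta>: "\<delta> > 0" and \<delta>_bd: "\<And>z. z \<in> closure W \<Longrightarrow> 0 < \<sigma> * Re ((z - \<mu>) * cnj e) \<Longrightarrow>
          \<sigma> * Re ((z - \<mu>) * cnj e) \<le> \<delta> \<Longrightarrow> K * (Re ((z - \<mu>) * cnj e))\<^sup>2 \<le> Im ((z - \<mu>) * cnj e)"
        using bd by blast
      have "K * (Re (cinner (B h) h))\<^sup>2 \<le> Im (cinner (B h) h) * (norm h)\<^sup>2"
        if h: "h \<in> D" "0 < \<sigma> * Re (cinner (B h) h)" "\<sigma> * Re (cinner (B h) h) \<le> \<delta> * (norm h)\<^sup>2" for h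
      proof -
        have "h \<noteq> 0" using h(2) by auto
        then obtain z where z: "z \<in> W" "cinner (B h) h = of_real ((norm h)\<^sup>2) * ((z - \<mu>) * cnj e)"
          using unit_form h(1) by blast
        define n \<zeta> where "n = (norm h)\<^sup>2" and "\<zeta> = (z - \<mu>) * cnj e"
        have n: "0 < n" using \<open>h \<noteq> 0\<close> by (simp add: n_def)
        have B\<zeta>: "Re (cinner (B h) h) = n * Re \<zeta>" "Im (cinner (B h) h) = n * Im \<zeta>"
          unfolding z(2) n_def [symmetric] \<zeta>_def [symmetric] by simp_all
        have "0 < n * (\<sigma> * Re \<zeta>)" using h(2) unfolding B\<zeta> by (simp add: mult.left_commute)
        then have 1: "0 < \<sigma> * Re \<zeta>" using n by (simp only: zero_less_mult_pos)
        have "n * (\<sigma> * Re \<zeta>) \<le> n * \<delta>"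
          using h(3) unfolding B\<zeta> n_def [symmetric] by (simp add: mult.commute mult.left_commute)
        then have 2: "\<sigma> * Re \<zeta> \<le> \<delta>" using n by simp
        have "K * (Re \<zeta>)\<^sup>2 \<le> Im \<zeta>"
          using \<delta>_bd [of z] closure_subset [of W] z(1) 1 2 unfolding \<zeta>_def by blast
        \<comment> \<open>Both sides scale by |h|^4, which turns the bound for unit vectors into the
          homogeneous one.\<close>
        then have "n * n * (K * (Re \<zeta>)\<^sup>2) \<le> n * n * Im \<zeta>"
          using n by (intro mult_left_mono) auto
        then show ?thesis
          unfolding B\<zeta> n_def [symmetric] by (simp add: power2_eq_square algebra_simps)
      qed
      then show "\<exists>\<delta>>0. \<forall>h\<in>D. 0 < \<sigma> * Re (cinner (B h) h) \<longrightarrow>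
        \<sigma> * Re (cinner (B h) h) \<le> \<delta> * (norm h)\<^sup>2 \<longrightarrow>
        K * (Re (cinner (B h) h))\<^sup>2 \<le> Im (cinner (B h) h) * (norm h)\<^sup>2"
        using \<delta> by blast
    next
      fix \<tau> :: real assume "0 < \<tau>"
      then obtain z where z: "z \<in> W" "0 < \<sigma> * Re ((z - \<mu>) * cnj e)"
          "Im ((z - \<mu>) * cnj e) < \<tau> * (\<sigma> * Re ((z - \<mu>) * cnj e))"
        using tangential_points [OF frame \<sigma>] by blast
      from z(1) obtain f where f: "f \<in> D" "norm f = 1" "z = cinner (A f) f"
        by (auto simp: W_def num_range_def)
      show "\<exists>f\<in>D. 0 < \<sigma> * Re (cinner (B f) f) \<and> Im (cinner (B f) f) < \<tau> * (\<sigma> * Re (cinner (B f) f))"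
        by (rule bexI [OF _ f(1)]) (use z(2,3) in \<open>simp only: B_unit [OF f(2)] f(3)\<close>)
    next
      fix r :: real assume "0 < r"
      moreover have "\<mu> \<in> closure W" using assms(7) by (simp add: W_def frontier_def)
      ultimately obtain z where z: "z \<in> W" "dist z \<mu> < r"
        using closure_approachable by blast
      from z(1) obtain f where f: "f \<in> D" "norm f = 1" "z = cinner (A f) f"
        by (auto simp: W_def num_range_def)
      have "norm (cinner (B f) f) \<le> r"
        using z(2) frame(1) by (simp add: B_unit [OF f(2)] f(3) norm_mult dist_norm)
      then show "\<exists>f\<in>D. norm f = 1 \<and> norm (cinner (B f) f) \<le> r" using f by blast
    qed
  qed
  then show ?thesis by (simp add: ess_spectrum_def fredholm_def)
qed

end
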